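(* Let $I\subseteq\mathbb{C}[z,\bar z]$ be an ideal, where $z=(z_1,\dots,z_n)$, $\bar z=(\bar z_1,\dots,\bar z_n)$. The following are equivalent: (Sf) every tuple $T=(T_1,\dots,T_n)$ of pairwise commuting complex square matrices (of the same size) satisfying $I\subseteq\ker(\psi_T)$ is normal; (G) $I$ is not contained in $I(a,b)$ for any pair $a\ne b$ in $\mathbb{C}^n$, and $I$ is not contained in $J(a,U)$ for any $a\in\mathbb{C}^n$ and any nonnegative (i.e. positive semidefinite) hermitian $n\times n$ matrix $U\neq0$.
   Context: $\mathbb{C}[z,\bar z]$ is the polynomial ring in $2n$ independent variables. For $f\in\mathbb{C}[z,\bar z]$ and $a,b\in\mathbb{C}^n$, $f(a,b)$ denotes the result of substituting $a$ for $z$ and $b$ for $\bar z$. Hereditary calculus: for a commuting tuple $T$ of complex matrices (with $T_j^*$ the conjugate transpose) and $f=\sum_{\alpha,\beta}c_{\alpha,\beta}z^\alpha\bar z^\beta$, $\psi_T(f)=f(T,T^* )=\sum_{\alpha,\beta}c_{\alpha,\beta}T^{*\beta}T^\alpha$ (all adjoints to the left). A commuting tuple $T$ is normal if every $T_j$ is normal. For $a\neq b$ in $\mathbb{C}^n$: $I(a,b)=\{f\in\mathbb{C}[z,\bar z]: f(a,\bar a)=f(b,\bar b)=f(a,\bar b)=f(b,\bar a)=0\}$. For $a\in\mathbb{C}^n$ and a hermitian $n\times n$ matrix $U\ne0$: $J(a,U)$ is the set of all $f\in\mathbb{C}[z,\bar z]$ such that (1) $f(a,\bar a)=0$; (2)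 $U\cdot\nabla_z f(a,\bar a)=0$ and $\overline U\cdot\nabla_{\bar z}f(a,\bar a)=0$; (3) $\operatorname{tr}\bigl(U\cdot\nabla^2_{z\bar z}f(a,\bar a)\bigr)=0$. Here $\nabla_zf=(\partial f/\partial z_j)_j$ and $\nabla_{\bar z}f=(\partial f/\partial\bar z_j)_j$ are column vectors, $\overline U$ is the entrywise complex conjugate of $U$, and $\nabla^2_{z\bar z}f=(\partial^2f/\partial z_j\partial\bar z_k)_{j,k=1,\dots,n}$. *)

theory Defs
  imports
    "HOL-Analysis.Determinants"
    "HOL-Library.Poly_Mapping"
    "Jordan_Normal_Form.Schur_Decomposition"
begin

no_notation Matrix.vec_index (infixl "$" 100)

text \<open>
  Conventions. The number n of variables is the cardinality of the index type \<open>'n\<close>. Points of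
  complex n-space and n by n matrices are indexed by \<open>'n\<close> (HOL-Analysis), whereas the entries of
  an operator tuple are matrices from Jordan_Normal_Form, because their size m is quantified
  inside the theorem.
\<close>

text \<open>
  The polynomial ring in 2n independent variables: \<open>Inl j\<close> is the index of z_j, and \<open>Inr j\<close> is
  that of the conjugate variable of z_j. A monomial is a finitely supported exponent function and
  a polynomial is a finitely supported function from monomials to coefficients, with convolution
  as multiplication.
\<close>

type_synonym 'n zpoly = "(('n + 'n) \<Rightarrow>\<^sub>0 nat) \<Rightarrow>\<^sub>0 complex"

text \<open>An ideal of a commutative ring is a submodule of the ring regarded as a module over itself.\<close>

definition is_ideal :: "'a::comm_ring_1 set \<Rightarrow> bool" where
  "is_ideal I \<longleftrightarrow> Modules.module.subspace (*) I"

lemma is_ideal_iff: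
  "is_ideal I \<longleftrightarrow> 0 \<in> I \<and> (\<forall>f\<in>I. \<forall>g\<in>I. f + g \<in> I) \<and> (\<forall>h. \<forall>f\<in>I. h * f \<in> I)"
proof -
  interpret Modules.module "(*) :: 'a \<Rightarrow> 'a \<Rightarrow> 'a"
    by unfold_locales (auto simp: algebra_simps)
  show ?thesis
    by (simp add: is_ideal_def subspace_def)
qed

definition poly_subst :: "'n::finite zpoly \<Rightarrow> complex^'n \<Rightarrow> complex^'n \<Rightarrow> complex" where
  "poly_subst f a b =
     (\<Sum>\<mu>\<in>Poly_Mapping.keys f. Poly_Mapping.lookup f \<mu> *
        (\<Prod>j\<in>UNIV. (a $ j) ^ Poly_Mapping.lookup \<mu> (Inl j)) *
        (\<Prod>j\<in>UNIV. (b $ j) ^ Poly_Mapping.lookup \<mu> (Inr j)))"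

text \<open>
  Formal partial derivative with respect to the variable of index v. If v does not occur in a
  monomial, the truncated subtraction of exponents is harmless because the coefficient is zero.
\<close>

definition pdiff :: "'n + 'n \<Rightarrow> 'n zpoly \<Rightarrow> 'n zpoly" where
  "pdiff v f =
     (\<Sum>\<mu>\<in>Poly_Mapping.keys f.
        Poly_Mapping.single (\<mu> - Poly_Mapping.single v 1)
          (of_nat (Poly_Mapping.lookup \<mu> v) * Poly_Mapping.lookup f \<mu>))"

definition cnj_vec :: "complex^'n \<Rightarrow> complex^'n" where
  "cnj_vec a = (\<chi> j. cnj (a $ j))"

definition cnj_mat :: "complex^'n^'n \<Rightarrow> complex^'n^'n" where
  "cnj_mat U = (\<chi> j k. cnj (U $ j $ k))"

definition grad_z :: "'n::finite zpoly \<Rightarrow> complex^'n \<Rightarrow> complex^'n \<Rightarrow> complex^'n" where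
  "grad_z f a b = (\<chi> j. poly_subst (pdiff (Inl j) f) a b)"

definition grad_zbar :: "'n::finite zpoly \<Rightarrow> complex^'n \<Rightarrow> complex^'n \<Rightarrow> complex^'n" where
  "grad_zbar f a b = (\<chi> j. poly_subst (pdiff (Inr j) f) a b)"

definition hess_z_zbar :: "'n::finite zpoly \<Rightarrow> complex^'n \<Rightarrow> complex^'n \<Rightarrow> complex^'n^'n" where
  "hess_z_zbar f a b = (\<chi> j k. poly_subst (pdiff (Inl j) (pdiff (Inr k) f)) a b)"

definition ideal_I :: "complex^'n \<Rightarrow> complex^'n \<Rightarrow> 'n::finite zpoly set" where
  "ideal_I a b =
     {f. poly_subst f a (cnj_vec a) = 0 \<and> poly_subst f b (cnj_vec b) = 0 \<and>
         poly_subst f a (cnj_vec b) = 0 \<and> poly_subst f b (cnj_vec a) = 0}"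

definition ideal_J :: "complex^'n \<Rightarrow> complex^'n^'n \<Rightarrow> 'n::finite zpoly set" where
  "ideal_J a U =
     {f. poly_subst f a (cnj_vec a) = 0 \<and>
         U *v grad_z f a (cnj_vec a) = 0 \<and>
         cnj_mat U *v grad_zbar f a (cnj_vec a) = 0 \<and>
         trace (U ** hess_z_zbar f a (cnj_vec a)) = 0}"

definition hermitian_matrix :: "complex^'n^'n \<Rightarrow> bool" where
  "hermitian_matrix U \<longleftrightarrow> (\<forall>j k. U $ j $ k = cnj (U $ k $ j))"

text \<open>For a hermitian matrix the quadratic form is real, so that the real part only serves as a
  coercion.\<close>

definition nonneg_hermitian :: "complex^'n^'n \<Rightarrow> bool" where
  "nonneg_hermitian U \<longleftrightarrow> hermitian_matrix U \<and>
     (\<forall>x::complex^'n. 0 \<le> Re (\<Sum>j\<in>UNIV. \<Sum>k\<in>UNIV. cnj (x $ j) * U $ j $ k * x $ k))"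

definition commuting_tuple :: "nat \<Rightarrow> ('n \<Rightarrow> complex mat) \<Rightarrow> bool" where
  "commuting_tuple m T \<longleftrightarrow>
     (\<forall>j. T j \<in> carrier_mat m m) \<and> (\<forall>j k. T j * T k = T k * T j)"

definition normal_tuple :: "('n \<Rightarrow> complex mat) \<Rightarrow> bool" where
  "normal_tuple T \<longleftrightarrow> (\<forall>j. T j * mat_adjoint (T j) = mat_adjoint (T j) * T j)"

text \<open>
  The product of the powers \<open>T j ^\<^sub>m \<alpha> j\<close> over all j, for a commuting tuple of m by m matrices.
  As \<open>'n\<close> carries no order, the product is a fold over the index set; for a commuting tuple it
  equals the product in any order, as the lemma \<open>tuple_power_eq_foldr\<close> states.
\<close>

definition tuple_power :: "nat \<Rightarrow> ('n::finite \<Rightarrow> complex mat) \<Rightarrow> ('n \<Rightarrow> nat) \<Rightarrow> complex mat" where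
  "tuple_power m T \<alpha> = Finite_Set.fold (\<lambda>j A. T j ^\<^sub>m \<alpha> j * A) (1\<^sub>m m) UNIV"

text \<open>
  The hereditary calculus, with all adjoints to the left. The sum of m by m matrices is formed
  entrywise because the type of all matrices is not an additive monoid.
\<close>

definition hereditary :: "nat \<Rightarrow> ('n::finite \<Rightarrow> complex mat) \<Rightarrow> 'n zpoly \<Rightarrow> complex mat" where
  "hereditary m T f = Matrix.mat m m (\<lambda>(p, q).
     \<Sum>\<mu>\<in>Poly_Mapping.keys f. Poly_Mapping.lookup f \<mu> *
       (tuple_power m (\<lambda>j. mat_adjoint (T j)) (\<lambda>j. Poly_Mapping.lookup \<mu> (Inr j)) *
        tuple_power m T (\<lambda>j. Poly_Mapping.lookup \<mu> (Inl j))) $$ (p, q))"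

definition hereditary_kernel :: "nat \<Rightarrow> ('n::finite \<Rightarrow> complex mat) \<Rightarrow> 'n zpoly set" where
  "hereditary_kernel m T = {f. hereditary m T f = 0\<^sub>m m m}"

lemma pow_mat_commute:
  fixes A B :: "complex mat"
  assumes A: "A \<in> carrier_mat m m" and B: "B \<in> carrier_mat m m" and AB: "A * B = B * A"
  shows "A ^\<^sub>m k * B = B * A ^\<^sub>m k"
proof (induction k)
  case 0
  then show ?case using A B by simp
next
  case (Suc k)
  have P: "A ^\<^sub>m k \<in> carrier_mat m m" using A by simp
  have "A ^\<^sub>m Suc k * B = A ^\<^sub>m k * (A * B)" using P A B by (simp add: assoc_mult_mat[of _ m m _ m _ m])
  also have "\<dots> = (A ^\<^sub>m k * B) * A" using P A B by (simp add: AB assoc_mult_mat[of _ m m _ m _ m])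
  also have "\<dots> = B * (A ^\<^sub>m k * A)" using P A B by (simp add: Suc assoc_mult_mat[of _ m m _ m _ m])
  finally show ?case by simp
qed

lemma tuple_power_eq_foldr:
  fixes T :: "'n::finite \<Rightarrow> complex mat"
  assumes T: "commuting_tuple m T" and xs: "distinct xs" "set xs = UNIV"
  shows "tuple_power m T \<alpha> = foldr (\<lambda>j A. T j ^\<^sub>m \<alpha> j * A) xs (1\<^sub>m m)"
proof -
  let ?f = "\<lambda>j A. T j ^\<^sub>m \<alpha> j * A"
  let ?g = "\<lambda>j A. if A \<in> carrier_mat m m then T j ^\<^sub>m \<alpha> j * A else A"
  have car: "T j ^\<^sub>m k \<in> carrier_mat m m" for j k
    using T by (auto simp: commuting_tuple_def)
  have car': "T j \<in> carrier_mat m m" for j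
    using T by (auto simp: commuting_tuple_def)
  have com: "T j ^\<^sub>m k * T i ^\<^sub>m l = T i ^\<^sub>m l * T j ^\<^sub>m k" for i j k l
  proof -
    have "T i ^\<^sub>m l * T j = T j * T i ^\<^sub>m l"
      using T by (intro pow_mat_commute[of _ m]) (auto simp: commuting_tuple_def)
    then show ?thesis
      using pow_mat_commute[OF car' car, of j i l k] by simp
  qed
  have closed: "?f j A \<in> carrier_mat m m" if "A \<in> carrier_mat m m" for j A
    using car that by (rule mult_carrier_mat)
  have swap: "?f j (?f i A) = ?f i (?f j A)" if "A \<in> carrier_mat m m" for i j A
    by (simp only: assoc_mult_mat[OF car car that, symmetric] com)
  interpret Finite_Set.comp_fun_commute_on UNIV ?g
  proof
    fix i j
    show "?g j \<circ> ?g i = ?g i \<circ> ?g j"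
      using swap[of _ i j] closed by (auto simp: fun_eq_iff)
  qed
  have "tuple_power m T \<alpha> = Finite_Set.fold ?g (1\<^sub>m m) UNIV"
    unfolding tuple_power_def
    by (rule fold_closed_eq[where B = "carrier_mat m m"]) (use closed in auto)
  also have "\<dots> = foldr ?g xs (1\<^sub>m m)"
  proof -
    have "foldr ?g ys (1\<^sub>m m) = Finite_Set.fold ?g (1\<^sub>m m) (set ys)" if "distinct ys" for ys
      using that by (induction ys) (simp_all add: fold_insert)
    then show ?thesis using xs by simp
  qed
  also have "\<dots> = foldr ?f xs (1\<^sub>m m)"
  proof -
    have "foldr ?f ys (1\<^sub>m m) \<in> carrier_mat m m \<and> foldr ?g ys (1\<^sub>m m) = foldr ?f ys (1\<^sub>m m)" for ys
      by (induction ys) (use closed in auto)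
    then show ?thesis by simp
  qed
  finally show ?thesis .
qed

end

(*
  In both directions everything is read off the sesquilinear form of psi_T(f) on first-order jets,
  i.e. vectors x with T_j x = a_j x + u_j, where all u_j are joint eigenvectors for a:
  <psi_T(f) x, y> is a combination of the values of f and of its first and mixed second derivatives
  at (a, conj b).

  If T is not normal, then either two joint eigenvectors for different joint eigenvalues a, b are
  not orthogonal, which puts ker psi_T into I(a,b), or the joint eigenvectors do not span and there
  is a genuine jet x with some u_j nonzero. In the latter case the Gram matrix
  U_kj = <u_j, u_k> puts ker psi_T into J(a,U). Conversely, I(a,b) is contained in the kernel of a
  2 by 2 tuple with non-orthogonal eigenvectors for a and b, and a Gram factorization of U turns
  J(a,U) into a subset of the kernel of a tuple a_j + N_j with N_j N_k = 0.
*)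

theory Submission
  imports Defs
begin

section \<open>Linear functionals on polynomials\<close>

text \<open>Two points are delicate. A vector outside the span E of the joint eigenvectors need not
  be a jet: even if it is an eigenvector modulo E, its increments u_j are sums of eigenvectors for
  several eigenvalues, and the unwanted ones have to be removed without pushing the vector into E.
  Moreover, pairing a jet x with itself produces gradient terms with the inner products of u_j and
  x, about which U says nothing directly. They vanish because the kernel of a Gram matrix consists
  of the linear relations between its vectors: U g = 0 forces the combination of the u_j with
  coefficients g_j to be zero, not merely orthogonal to every u_k. For the same reason condition (2)
  of J(a,U) is strong enough in the converse construction, where the increments are paired with
  arbitrary vectors.\<close>

definition eval_mon :: "('n::finite \<Rightarrow> nat) \<Rightarrow> complex^'n \<Rightarrow> complex" where
  "eval_mon \<alpha> a = (\<Prod>j\<in>UNIV. (a $ j) ^ \<alpha> j)"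

text \<open>The j-th partial derivative of \<open>eval_mon\<close>. For
  \<open>\<alpha> j = 0\<close> the truncated exponent is harmless, because the factor in front is
  zero.\<close>

definition diff_mon :: "'n::finite \<Rightarrow> ('n \<Rightarrow> nat) \<Rightarrow> complex^'n \<Rightarrow> complex" where
  "diff_mon j \<alpha> a = of_nat (\<alpha> j) * eval_mon (\<alpha>(j := \<alpha> j - 1)) a"

lemma eval_mon_cnj: "eval_mon \<alpha> (cnj_vec a) = cnj (eval_mon \<alpha> a)"
  by (simp add: eval_mon_def cnj_vec_def)

lemma diff_mon_cnj: "diff_mon j \<alpha> (cnj_vec a) = cnj (diff_mon j \<alpha> a)"
  by (simp add: diff_mon_def eval_mon_cnj)

text \<open>Values, derivatives and the sesquilinear form of the hereditary calculus are all linear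
  in the polynomial. Written in this form, two of them can be compared monomial by monomial.\<close>

definition linear_ext :: "('m \<Rightarrow> complex) \<Rightarrow> ('m \<Rightarrow>\<^sub>0 complex) \<Rightarrow> complex" where
  "linear_ext h f = (\<Sum>\<mu>\<in>Poly_Mapping.keys f. Poly_Mapping.lookup f \<mu> * h \<mu>)"

text \<open>Cancellation can make the keys of a sum smaller than the union of the keys, so
  additivity is checked on a common finite superset.\<close>

lemma linear_ext_superset:
  assumes "finite A" "Poly_Mapping.keys f \<subseteq> A"
  shows "linear_ext h f = (\<Sum>\<mu>\<in>A. Poly_Mapping.lookup f \<mu> * h \<mu>)"
  unfolding linear_ext_def
  by (rule sum.mono_neutral_left) (use assms in \<open>auto simp: in_keys_iff\<close>)

lemma linear_ext_add: "linear_ext h (f + g) = linear_ext h f + linear_ext h g"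
proof -
  let ?A = "Poly_Mapping.keys f \<union> Poly_Mapping.keys g"
  have "linear_ext h (f + g) = (\<Sum>\<mu>\<in>?A. Poly_Mapping.lookup (f + g) \<mu> * h \<mu>)"
    by (rule linear_ext_superset) (simp_all add: Poly_Mapping.keys_add)
  then show ?thesis
    by (simp add: linear_ext_superset[of ?A] lookup_add algebra_simps sum.distrib)
qed

lemma linear_ext_single: "linear_ext h (Poly_Mapping.single \<mu> c) = c * h \<mu>"
  by (simp add: linear_ext_def)

lemma linear_ext_sum: "linear_ext h (\<Sum>i\<in>A. f i) = (\<Sum>i\<in>A. linear_ext h (f i))"
  by (induction A rule: infinite_finite_induct)
    (simp_all add: linear_ext_add, simp_all add: linear_ext_def)

text \<open>Differentiation is moved from the polynomial to the functional, which leaves a statement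
  about exponents only.\<close>

lemma linear_ext_pdiff:
  "linear_ext h (pdiff v f) =
     linear_ext (\<lambda>\<mu>. of_nat (Poly_Mapping.lookup \<mu> v) * h (\<mu> - Poly_Mapping.single v 1)) f"
  by (simp add: pdiff_def linear_ext_sum linear_ext_single)
    (simp add: linear_ext_def mult_ac)

abbreviation z_exps :: "('n + 'n \<Rightarrow>\<^sub>0 nat) \<Rightarrow> 'n \<Rightarrow> nat" where
  "z_exps \<mu> \<equiv> \<lambda>j. Poly_Mapping.lookup \<mu> (Inl j)"

abbreviation zbar_exps :: "('n + 'n \<Rightarrow>\<^sub>0 nat) \<Rightarrow> 'n \<Rightarrow> nat" where
  "zbar_exps \<mu> \<equiv> \<lambda>j. Poly_Mapping.lookup \<mu> (Inr j)"

lemma exps_minus: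
  "z_exps (\<mu> - Poly_Mapping.single (Inl j) 1) = (z_exps \<mu>)(j := z_exps \<mu> j - 1)"
  "zbar_exps (\<mu> - Poly_Mapping.single (Inl j) 1) = zbar_exps \<mu>"
  "z_exps (\<mu> - Poly_Mapping.single (Inr j) 1) = z_exps \<mu>"
  "zbar_exps (\<mu> - Poly_Mapping.single (Inr j) 1) = (zbar_exps \<mu>)(j := zbar_exps \<mu> j - 1)"
  by (auto simp: fun_eq_iff lookup_minus lookup_single)

lemma poly_subst_eq:
  "poly_subst f a b = linear_ext (\<lambda>\<mu>. eval_mon (z_exps \<mu>) a * eval_mon (zbar_exps \<mu>) b) f"
  by (simp add: poly_subst_def linear_ext_def eval_mon_def mult.assoc)

lemma poly_subst_pdiff_z:
  "poly_subst (pdiff (Inl j) f) a b =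
     linear_ext (\<lambda>\<mu>. diff_mon j (z_exps \<mu>) a * eval_mon (zbar_exps \<mu>) b) f"
  unfolding poly_subst_eq linear_ext_pdiff exps_minus diff_mon_def by (simp add: mult.assoc)

lemma poly_subst_pdiff_zbar:
  "poly_subst (pdiff (Inr k) f) a b =
     linear_ext (\<lambda>\<mu>. eval_mon (z_exps \<mu>) a * diff_mon k (zbar_exps \<mu>) b) f"
  unfolding poly_subst_eq linear_ext_pdiff exps_minus diff_mon_def by (simp add: mult_ac)

lemma poly_subst_pdiff_z_zbar:
  "poly_subst (pdiff (Inl j) (pdiff (Inr k) f)) a b =
     linear_ext (\<lambda>\<mu>. diff_mon j (z_exps \<mu>) a * diff_mon k (zbar_exps \<mu>) b) f"
  unfolding poly_subst_eq linear_ext_pdiff exps_minus diff_mon_def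
  by (simp add: mult_ac lookup_minus lookup_single)

section \<open>The hereditary calculus on first-order jets\<close>

notation Matrix.vec_index (infixl "$v" 100)

section \<open>Inner products, adjoints and monomials in a tuple\<close>

lemma cscalar_prod_sum:
  fixes x y :: "complex vec"
  assumes "y \<in> carrier_vec m"
  shows "x \<bullet>c y = (\<Sum>i<m. x $v i * cnj (y $v i))"
  using assms by (simp add: scalar_prod_def lessThan_atLeast0)

lemma mult_mat_vec_sum:
  assumes "A \<in> carrier_mat m m" "x \<in> carrier_vec m" "i < m"
  shows "(A *\<^sub>v x) $v i = (\<Sum>l<m. A $$ (i, l) * x $v l)"
  using assms by (simp add: scalar_prod_def lessThan_atLeast0)

lemma mat_adjoint_carrier [simp]: "A \<in> carrier_mat m m \<Longrightarrow> mat_adjoint A \<in> carrier_mat m m"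
  unfolding mat_adjoint_def by (auto simp: mat_of_rows_def)

lemma mat_adjoint_index:
  fixes A :: "complex mat"
  assumes "A \<in> carrier_mat m m" "i < m" "j < m"
  shows "mat_adjoint A $$ (i, j) = cnj (A $$ (j, i))"
  using assms unfolding mat_adjoint_def by (simp add: mat_of_rows_def)

lemma mat_adjoint_cscalar_prod:
  fixes A :: "complex mat"
  assumes A: "A \<in> carrier_mat m m" and x: "x \<in> carrier_vec m" and y: "y \<in> carrier_vec m"
  shows "(mat_adjoint A *\<^sub>v x) \<bullet>c y = x \<bullet>c (A *\<^sub>v y)"
proof -
  have Ay: "A *\<^sub>v y \<in> carrier_vec m" using A y by simp
  have "(mat_adjoint A *\<^sub>v x) \<bullet>c y = (\<Sum>i<m. \<Sum>l<m. cnj (A $$ (l, i)) * x $v l * cnj (y $v i))"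
    using A x
    by (simp add: cscalar_prod_sum[OF y] mult_mat_vec_sum[of _ m] mat_adjoint_index[of _ m]
        sum_distrib_right del: index_mult_mat_vec)
  also have "\<dots> = x \<bullet>c (A *\<^sub>v y)"
    using A y
    by (subst sum.swap)
      (simp add: cscalar_prod_sum[OF Ay] mult_mat_vec_sum[of _ m] sum_distrib_left mult_ac
        del: index_mult_mat_vec)
  finally show ?thesis .
qed

lemma mat_adjoint_pow_cscalar_prod:
  fixes A :: "complex mat"
  assumes A: "A \<in> carrier_mat m m" and x: "x \<in> carrier_vec m" and y: "y \<in> carrier_vec m"
  shows "(mat_adjoint A ^\<^sub>m p *\<^sub>v x) \<bullet>c y = x \<bullet>c (A ^\<^sub>m p *\<^sub>v y)"
  using x y
proof (induction p arbitrary: x y)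
  case 0
  then show ?case using A by (simp add: mat_adjoint_carrier[OF A, THEN carrier_matD(1)])
next
  case (Suc p)
  have A': "mat_adjoint A \<in> carrier_mat m m" using A by simp
  have "mat_adjoint A ^\<^sub>m Suc p *\<^sub>v x = mat_adjoint A ^\<^sub>m p *\<^sub>v (mat_adjoint A *\<^sub>v x)"
    using A' Suc.prems by (simp add: assoc_mult_mat_vec[of _ m m _ m])
  \<comment> \<open>Matrix powers put the new factor on the right; moving the adjoint across the
    inner product needs it on the left.\<close>
  moreover have "A ^\<^sub>m Suc p = A * A ^\<^sub>m p"
    using pow_mat_commute[OF A A refl] by simp
  then have "A ^\<^sub>m Suc p *\<^sub>v y = A *\<^sub>v (A ^\<^sub>m p *\<^sub>v y)"
    using A Suc.prems by (simp add: assoc_mult_mat_vec[of _ m m _ m])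
  moreover have "mat_adjoint A *\<^sub>v x \<in> carrier_vec m" "A ^\<^sub>m p *\<^sub>v y \<in> carrier_vec m"
    using A A' Suc.prems by (auto intro!: mult_mat_vec_carrier pow_carrier_mat)
  ultimately show ?case
    using Suc.IH[of "mat_adjoint A *\<^sub>v x" y] Suc.prems A by (simp add: mat_adjoint_cscalar_prod)
qed

lemma commuting_tuple_carrier: "commuting_tuple m T \<Longrightarrow> T j \<in> carrier_mat m m"
  by (simp add: commuting_tuple_def)

lemma mat_adjoint_mult:
  fixes A B :: "complex mat"
  assumes "A \<in> carrier_mat m m" "B \<in> carrier_mat m m"
  shows "mat_adjoint (A * B) = mat_adjoint B * mat_adjoint A"
proof (rule eq_matI)
  note car = mat_adjoint_carrier[OF assms(1)] mat_adjoint_carrier[OF assms(2)]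
    mat_adjoint_carrier[OF mult_carrier_mat[OF assms]]
  show "dim_row (mat_adjoint (A * B)) = dim_row (mat_adjoint B * mat_adjoint A)"
    "dim_col (mat_adjoint (A * B)) = dim_col (mat_adjoint B * mat_adjoint A)"
    using car assms by (simp_all only: carrier_matD index_mult_mat)
  fix i j assume "i < dim_row (mat_adjoint B * mat_adjoint A)"
    "j < dim_col (mat_adjoint B * mat_adjoint A)"
  then have "i < m" "j < m" using car by auto
  then show "mat_adjoint (A * B) $$ (i, j) = (mat_adjoint B * mat_adjoint A) $$ (i, j)"
    using assms carrier_matD[OF car(1)] carrier_matD[OF car(2)]
    by (simp add: mat_adjoint_index[of _ m] scalar_prod_def mult.commute)
qed

lemma commuting_tuple_adjoint:
  assumes "commuting_tuple m T"
  shows "commuting_tuple m (\<lambda>j. mat_adjoint (T j))"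
  using assms mat_adjoint_mult[of _ m]
  by (simp add: commuting_tuple_def) metis

lemma tuple_power_vec:
  fixes T :: "'n::finite \<Rightarrow> complex mat"
  assumes T: "commuting_tuple m T" and xs: "distinct xs" "set xs = UNIV" and x: "x \<in> carrier_vec m"
  shows "tuple_power m T \<alpha> \<in> carrier_mat m m"
    and "tuple_power m T \<alpha> *\<^sub>v x = foldr (\<lambda>j y. T j ^\<^sub>m \<alpha> j *\<^sub>v y) xs x"
proof -
  note car = commuting_tuple_carrier[OF T]
  have "foldr (\<lambda>j A. T j ^\<^sub>m \<alpha> j * A) ys (1\<^sub>m m) \<in> carrier_mat m m \<and>
    foldr (\<lambda>j A. T j ^\<^sub>m \<alpha> j * A) ys (1\<^sub>m m) *\<^sub>v x = foldr (\<lambda>j y. T j ^\<^sub>m \<alpha> j *\<^sub>v y) ys x" for ys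
  proof (induction ys)
    case Nil
    then show ?case using x by simp
  next
    case (Cons j ys)
    then show ?case
      using car[of j] x by (auto simp: assoc_mult_mat_vec[of _ m m _ m] intro!: mult_carrier_mat)
  qed
  from this[of xs] show "tuple_power m T \<alpha> \<in> carrier_mat m m"
    "tuple_power m T \<alpha> *\<^sub>v x = foldr (\<lambda>j y. T j ^\<^sub>m \<alpha> j *\<^sub>v y) xs x"
    by (simp_all add: tuple_power_eq_foldr[OF T xs])
qed

lemma tuple_power_carrier:
  fixes T :: "'n::finite \<Rightarrow> complex mat"
  assumes "commuting_tuple m T"
  shows "tuple_power m T \<alpha> \<in> carrier_mat m m"
  using finite_distinct_list[of "UNIV :: 'n set"] tuple_power_vec(1)[OF assms _ _ zero_carrier_vec]
  by auto

text \<open>Taking adjoints reverses the order of the factors. This does no harm, since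
  \<open>tuple_power\<close> may be evaluated along any enumeration of the indices: the adjoints use
  \<open>xs\<close> and the tuple itself uses \<open>rev xs\<close>.\<close>

lemma tuple_power_adjoint:
  fixes T :: "'n::finite \<Rightarrow> complex mat"
  assumes T: "commuting_tuple m T" and x: "x \<in> carrier_vec m" and y: "y \<in> carrier_vec m"
  shows "(tuple_power m (\<lambda>j. mat_adjoint (T j)) \<alpha> *\<^sub>v x) \<bullet>c y = x \<bullet>c (tuple_power m T \<alpha> *\<^sub>v y)"
proof -
  obtain xs where xs: "distinct xs" "set xs = (UNIV :: 'n set)"
    using finite_distinct_list[of "UNIV :: 'n set"] by auto
  then have rev: "distinct (rev xs)" "set (rev xs) = (UNIV :: 'n set)" by auto
  note car = commuting_tuple_carrier[OF T]
  have fold_car: "foldr (\<lambda>j y. mat_adjoint (T j) ^\<^sub>m \<alpha> j *\<^sub>v y) ys x \<in> carrier_vec m" for ys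
    using car x by (induction ys) (auto intro!: mult_mat_vec_carrier pow_carrier_mat)
  have "foldr (\<lambda>j y. mat_adjoint (T j) ^\<^sub>m \<alpha> j *\<^sub>v y) ys x \<bullet>c y =
    x \<bullet>c foldr (\<lambda>j y. T j ^\<^sub>m \<alpha> j *\<^sub>v y) (rev ys) y" for ys
    using y
  proof (induction ys arbitrary: y)
    case Nil
    then show ?case by simp
  next
    case (Cons j ys)
    have "T j ^\<^sub>m \<alpha> j *\<^sub>v y \<in> carrier_vec m"
      using car[of j] Cons.prems by (auto intro!: mult_mat_vec_carrier pow_carrier_mat)
    then show ?case
      using Cons mat_adjoint_pow_cscalar_prod[OF car fold_car Cons.prems] by simp
  qed
  then show ?thesis
    by (simp add: tuple_power_vec(2)[OF T rev y]
        tuple_power_vec(2)[OF commuting_tuple_adjoint[OF T] xs x])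
qed

lemma hereditary_carrier: "hereditary m T f \<in> carrier_mat m m"
  by (simp add: hereditary_def)

text \<open>Since all adjoints stand on the left, they move to the second argument, and the form
  depends only on how monomials in T itself act on x and y.\<close>

lemma hereditary_cscalar_prod:
  fixes T :: "'n::finite \<Rightarrow> complex mat"
  assumes T: "commuting_tuple m T" and x: "x \<in> carrier_vec m" and y: "y \<in> carrier_vec m"
  shows "(hereditary m T f *\<^sub>v x) \<bullet>c y =
    linear_ext (\<lambda>\<mu>. (tuple_power m T (z_exps \<mu>) *\<^sub>v x) \<bullet>c (tuple_power m T (zbar_exps \<mu>) *\<^sub>v y)) f"
proof -
  let ?A = "\<lambda>\<mu>. tuple_power m (\<lambda>j. mat_adjoint (T j)) (zbar_exps \<mu>)"
  let ?B = "\<lambda>\<mu>. tuple_power m T (z_exps \<mu>)"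
  have A: "?A \<mu> \<in> carrier_mat m m" for \<mu>
    by (rule tuple_power_carrier[OF commuting_tuple_adjoint[OF T]])
  have B: "?B \<mu> \<in> carrier_mat m m" for \<mu>
    by (rule tuple_power_carrier[OF T])
  have Bx: "?B \<mu> *\<^sub>v x \<in> carrier_vec m" for \<mu>
    using B x by (rule mult_mat_vec_carrier)
  have entry: "(hereditary m T f *\<^sub>v x) $v p = linear_ext (\<lambda>\<mu>. (?A \<mu> *\<^sub>v (?B \<mu> *\<^sub>v x)) $v p) f"
    if p: "p < m" for p
  proof -
    have "(hereditary m T f *\<^sub>v x) $v p =
      (\<Sum>q<m. linear_ext (\<lambda>\<mu>. (?A \<mu> * ?B \<mu>) $$ (p, q)) f * x $v q)"
      by (subst mult_mat_vec_sum[OF hereditary_carrier x p])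
        (use p in \<open>simp add: hereditary_def linear_ext_def\<close>)
    also have "\<dots> = linear_ext (\<lambda>\<mu>. \<Sum>q<m. (?A \<mu> * ?B \<mu>) $$ (p, q) * x $v q) f"
      by (simp add: linear_ext_def sum_distrib_right sum_distrib_left sum.swap[of _ _ "{..<m}"] mult.assoc)
    also have "\<dots> = linear_ext (\<lambda>\<mu>. (?A \<mu> *\<^sub>v (?B \<mu> *\<^sub>v x)) $v p) f"
      using p by (simp only: assoc_mult_mat_vec[OF A B x, symmetric]
          mult_mat_vec_sum[OF mult_carrier_mat[OF A B] x])
    finally show ?thesis .
  qed
  have "(hereditary m T f *\<^sub>v x) \<bullet>c y = linear_ext (\<lambda>\<mu>. (?A \<mu> *\<^sub>v (?B \<mu> *\<^sub>v x)) \<bullet>c y) f"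
    using entry by (simp add: cscalar_prod_sum[OF y] linear_ext_def sum_distrib_right
        sum_distrib_left sum.swap[of _ _ "{..<m}"] mult.assoc del: index_mult_mat_vec)
  then show ?thesis
    by (simp add: tuple_power_adjoint[OF T Bx y])
qed

section \<open>Jets and the hereditary form on them\<close>

text \<open>Every product of two operators T_j - a_j kills x, so p(T) x depends only on the value
  and the gradient of p at a. Joint eigenvectors are the case in which all \<open>u j\<close> are
  zero.\<close>

definition first_order_jet ::
  "nat \<Rightarrow> ('n \<Rightarrow> complex mat) \<Rightarrow> complex^'n \<Rightarrow> complex vec \<Rightarrow> ('n \<Rightarrow> complex vec) \<Rightarrow> bool" where
  "first_order_jet m T a x u \<longleftrightarrow> x \<in> carrier_vec m \<and>
     (\<forall>j. u j \<in> carrier_vec m \<and> T j *\<^sub>v x = a $ j \<cdot>\<^sub>v x + u j \<and> (\<forall>k. T k *\<^sub>v u j = a $ k \<cdot>\<^sub>v u j))"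

text \<open>If \<open>c\<close> and \<open>d\<close> are the value and the gradient of a polynomial
  p at the base point of the jet, this vector is p(T) x.\<close>

definition jet_vec ::
  "nat \<Rightarrow> complex vec \<Rightarrow> ('n::finite \<Rightarrow> complex vec) \<Rightarrow> complex \<Rightarrow> ('n \<Rightarrow> complex) \<Rightarrow> complex vec" where
  "jet_vec m x u c d = Matrix.vec m (\<lambda>i. c * x $v i + (\<Sum>j\<in>UNIV. d j * u j $v i))"

lemma jet_vec_carrier [simp]: "jet_vec m x u c d \<in> carrier_vec m"
  by (simp add: jet_vec_def)

lemma jet_vec_one: "x \<in> carrier_vec m \<Longrightarrow> jet_vec m x u 1 (\<lambda>_. 0) = x"
  by (auto simp: jet_vec_def)

text \<open>This is the product rule: multiplication of a polynomial by the k-th variable changes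
  its value and gradient at \<open>a\<close> in exactly this way.\<close>

lemma mult_jet_vec:
  assumes T: "\<And>k. T k \<in> carrier_mat m m" and jet: "first_order_jet m T a x u"
  shows "T k *\<^sub>v jet_vec m x u c d =
    jet_vec m x u (c * a $ k) (\<lambda>j. d j * a $ k + (if j = k then c else 0))"
proof (rule eq_vecI)
  fix i assume "i < dim_vec (jet_vec m x u (c * a $ k) (\<lambda>j. d j * a $ k + (if j = k then c else 0)))"
  then have i: "i < m" by (simp add: jet_vec_def)
  have x: "x \<in> carrier_vec m" and u: "u j \<in> carrier_vec m"
    and Tx: "T k *\<^sub>v x = a $ k \<cdot>\<^sub>v x + u k" and Tu: "T k *\<^sub>v u j = a $ k \<cdot>\<^sub>v u j" for j
    using jet by (auto simp: first_order_jet_def)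
  have "(T k *\<^sub>v jet_vec m x u c d) $v i = (\<Sum>l<m. T k $$ (i, l) * (c * x $v l + (\<Sum>j\<in>UNIV. d j * u j $v l)))"
    using i by (simp only: mult_mat_vec_sum[OF T jet_vec_carrier i]) (simp add: jet_vec_def)
  also have "\<dots> = c * (T k *\<^sub>v x) $v i + (\<Sum>j\<in>UNIV. d j * (T k *\<^sub>v u j) $v i)"
    by (simp add: mult_mat_vec_sum[OF T x i] mult_mat_vec_sum[OF T u i] distrib_left sum.distrib
        sum_distrib_left sum.swap[of _ _ "{..<m}"] mult_ac del: index_mult_mat_vec)
  also have "\<dots> = c * (a $ k * x $v i + u k $v i) + (\<Sum>j\<in>UNIV. d j * (a $ k * u j $v i))"
    using i x u by (simp add: Tx Tu carrier_vecD[OF x] carrier_vecD[OF u] del: index_mult_mat_vec)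
  also have "\<dots> = (c * a $ k) * x $v i + (\<Sum>j\<in>UNIV. (d j * a $ k + (if j = k then c else 0)) * u j $v i)"
    by (simp add: algebra_simps sum.distrib if_distrib[of "\<lambda>t. _ * t"] cong: if_cong)
  finally show "(T k *\<^sub>v jet_vec m x u c d) $v i =
    jet_vec m x u (c * a $ k) (\<lambda>j. d j * a $ k + (if j = k then c else 0)) $v i"
    using i by (simp add: jet_vec_def)
qed (use T[of k] in \<open>simp add: jet_vec_def\<close>)

lemma pow_mult_jet_vec:
  assumes T: "\<And>k. T k \<in> carrier_mat m m" and jet: "first_order_jet m T a x u"
  shows "T k ^\<^sub>m p *\<^sub>v jet_vec m x u c d =
    jet_vec m x u (c * (a $ k) ^ p)
      (\<lambda>j. d j * (a $ k) ^ p + (if j = k then c * of_nat p * (a $ k) ^ (p - 1) else 0))"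
proof (induction p arbitrary: c d)
  case 0
  have "(\<lambda>j. d j * (a $ k) ^ 0 + (if j = k then c * of_nat 0 * (a $ k) ^ (0 - 1) else 0)) = d"
    by auto
  moreover have "T k ^\<^sub>m 0 *\<^sub>v jet_vec m x u c d = jet_vec m x u c d"
    using carrier_matD[OF T] by simp
  ultimately show ?case by simp
next
  case (Suc p)
  have "T k ^\<^sub>m Suc p *\<^sub>v jet_vec m x u c d = T k ^\<^sub>m p *\<^sub>v (T k *\<^sub>v jet_vec m x u c d)"
    using T by (simp add: assoc_mult_mat_vec[of _ m m _ m])
  also have "\<dots> = jet_vec m x u (c * (a $ k) ^ Suc p)
     (\<lambda>j. d j * (a $ k) ^ Suc p + (if j = k then c * of_nat (Suc p) * (a $ k) ^ (Suc p - 1) else 0))"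
    unfolding mult_jet_vec[OF T jet] Suc.IH
    by (cases p) (auto intro!: arg_cong2[where f = "jet_vec m x u"] simp: fun_eq_iff algebra_simps)
  finally show ?case .
qed

text \<open>The coefficients are the value and the gradient of the partial monomial in the variables
  from \<open>xs\<close>; its derivatives in the other directions are zero.\<close>

lemma foldr_pow_jet_vec:
  fixes T :: "'n::finite \<Rightarrow> complex mat"
  assumes T: "\<And>k. T k \<in> carrier_mat m m" and jet: "first_order_jet m T a x u" and xs: "distinct xs"
  shows "foldr (\<lambda>j y. T j ^\<^sub>m \<alpha> j *\<^sub>v y) xs x =
    jet_vec m x u (\<Prod>i\<in>set xs. (a $ i) ^ \<alpha> i)
      (\<lambda>j. if j \<in> set xs
           then of_nat (\<alpha> j) * (a $ j) ^ (\<alpha> j - 1) * (\<Prod>i\<in>set xs - {j}. (a $ i) ^ \<alpha> i) else 0)"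
  using xs
proof (induction xs)
  case Nil
  then show ?case using jet by (simp add: jet_vec_one first_order_jet_def)
next
  case (Cons k xs)
  then have IH: "foldr (\<lambda>j y. T j ^\<^sub>m \<alpha> j *\<^sub>v y) xs x = jet_vec m x u (\<Prod>i\<in>set xs. (a $ i) ^ \<alpha> i)
      (\<lambda>j. if j \<in> set xs
           then of_nat (\<alpha> j) * (a $ j) ^ (\<alpha> j - 1) * (\<Prod>i\<in>set xs - {j}. (a $ i) ^ \<alpha> i) else 0)"
    and k: "k \<notin> set xs" by auto
  have "insert k (set xs) - {k} = set xs" using k by auto
  moreover have "insert k (set xs) - {j} = insert k (set xs - {j})" if "j \<in> set xs" for j
    using that k by auto
  ultimately show ?case
    using k
    by (simp add: IH pow_mult_jet_vec[OF T jet])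
      (auto intro!: arg_cong2[where f = "jet_vec m x u"] simp: fun_eq_iff)
qed

lemma tuple_power_jet:
  fixes T :: "'n::finite \<Rightarrow> complex mat"
  assumes T: "commuting_tuple m T" and jet: "first_order_jet m T a x u"
  shows "tuple_power m T \<alpha> *\<^sub>v x = jet_vec m x u (eval_mon \<alpha> a) (\<lambda>j. diff_mon j \<alpha> a)"
proof -
  obtain xs where xs: "distinct xs" "set xs = (UNIV :: 'n set)"
    using finite_distinct_list[of "UNIV :: 'n set"] by auto
  have x: "x \<in> carrier_vec m" using jet by (simp add: first_order_jet_def)
  have "diff_mon j \<alpha> a = of_nat (\<alpha> j) * (a $ j) ^ (\<alpha> j - 1) * (\<Prod>i\<in>UNIV - {j}. (a $ i) ^ \<alpha> i)" for j
    by (simp add: diff_mon_def eval_mon_def prod.remove[of UNIV j])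
  then show ?thesis
    by (simp add: tuple_power_vec(2)[OF T xs x] xs eval_mon_def
        foldr_pow_jet_vec[OF commuting_tuple_carrier[OF T] jet xs(1)])
qed

lemma jet_vec_cscalar_prod:
  fixes u v :: "'n::finite \<Rightarrow> complex vec"
  assumes "y \<in> carrier_vec m" "\<And>k. v k \<in> carrier_vec m"
  shows "jet_vec m x u c d \<bullet>c jet_vec m y v e g =
    c * cnj e * (x \<bullet>c y) + (\<Sum>j\<in>UNIV. d j * cnj e * (u j \<bullet>c y)) +
    (\<Sum>k\<in>UNIV. c * cnj (g k) * (x \<bullet>c v k)) +
    (\<Sum>j\<in>UNIV. \<Sum>k\<in>UNIV. d j * cnj (g k) * (u j \<bullet>c v k))"
proof -
  have "jet_vec m x u c d \<bullet>c jet_vec m y v e g =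
    (\<Sum>i<m. (c * x $v i + (\<Sum>j\<in>UNIV. d j * u j $v i)) *
      (cnj e * cnj (y $v i) + (\<Sum>k\<in>UNIV. cnj (g k) * cnj (v k $v i))))"
    by (simp add: cscalar_prod_sum[OF jet_vec_carrier]) (simp add: jet_vec_def)
  also have "\<dots> = (\<Sum>i<m. c * cnj e * (x $v i * cnj (y $v i)) +
      (\<Sum>j\<in>UNIV. d j * cnj e * (u j $v i * cnj (y $v i))) +
      (\<Sum>k\<in>UNIV. c * cnj (g k) * (x $v i * cnj (v k $v i))) +
      (\<Sum>j\<in>UNIV. \<Sum>k\<in>UNIV. d j * cnj (g k) * (u j $v i * cnj (v k $v i))))"
    by (intro sum.cong refl)
      (simp only: distrib_left distrib_right sum_product, simp add: sum_distrib_left sum_distrib_right mult_ac)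
  also have "\<dots> = c * cnj e * (x \<bullet>c y) + (\<Sum>j\<in>UNIV. d j * cnj e * (u j \<bullet>c y)) +
    (\<Sum>k\<in>UNIV. c * cnj (g k) * (x \<bullet>c v k)) +
    (\<Sum>j\<in>UNIV. \<Sum>k\<in>UNIV. d j * cnj (g k) * (u j \<bullet>c v k))"
    by (simp only: cscalar_prod_sum[OF assms(1)] cscalar_prod_sum[OF assms(2)] sum.distrib
        sum_distrib_left sum.swap[of _ _ "{..<m}"])
  finally show ?thesis .
qed

lemma linear_ext_combine:
  "linear_ext (\<lambda>\<mu>. h \<mu> + h' \<mu>) f = linear_ext h f + linear_ext h' f"
  "linear_ext (\<lambda>\<mu>. h \<mu> * s) f = linear_ext h f * s"
  "linear_ext (\<lambda>\<mu>. \<Sum>i\<in>A. H i \<mu>) f = (\<Sum>i\<in>A. linear_ext (H i) f)"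
  by (simp_all add: linear_ext_def algebra_simps sum.distrib sum_distrib_left sum_distrib_right
      sum.swap[of _ _ A])

text \<open>By linearity a monomial is enough, and there the form pairs two jets. Conjugation in the
  second argument turns derivatives at \<open>b\<close> into derivatives at
  \<open>cnj_vec b\<close>. Only mixed second derivatives arise, because each of the two jets is of
  first order.\<close>

lemma hereditary_jet:
  fixes T :: "'n::finite \<Rightarrow> complex mat"
  assumes T: "commuting_tuple m T"
    and x: "first_order_jet m T a x u" and y: "first_order_jet m T b y v"
  shows "(hereditary m T f *\<^sub>v x) \<bullet>c y =
    poly_subst f a (cnj_vec b) * (x \<bullet>c y) +
    (\<Sum>j\<in>UNIV. grad_z f a (cnj_vec b) $ j * (u j \<bullet>c y)) +
    (\<Sum>k\<in>UNIV. grad_zbar f a (cnj_vec b) $ k * (x \<bullet>c v k)) +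
    (\<Sum>j\<in>UNIV. \<Sum>k\<in>UNIV. hess_z_zbar f a (cnj_vec b) $ j $ k * (u j \<bullet>c v k))"
proof -
  have car: "x \<in> carrier_vec m" "y \<in> carrier_vec m" "v k \<in> carrier_vec m" for k
    using x y by (auto simp: first_order_jet_def)
  show ?thesis
    by (simp add: grad_z_def grad_zbar_def hess_z_zbar_def poly_subst_pdiff_z_zbar,
        simp add: poly_subst_pdiff_z poly_subst_pdiff_zbar)
      (simp add: hereditary_cscalar_prod[OF T car(1,2)] tuple_power_jet[OF T x]
        tuple_power_jet[OF T y] jet_vec_cscalar_prod[OF car(2,3)] linear_ext_combine
        poly_subst_eq eval_mon_cnj diff_mon_cnj)
qed

section \<open>Gram matrices\<close>

lemma cmod_sum_square:
  "of_real ((cmod (\<Sum>j\<in>A. f j))\<^sup>2) = (\<Sum>j\<in>A. \<Sum>k\<in>A. cnj (f j) * f k)"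
  unfolding complex_norm_square cnj_sum sum_product
  by (subst sum.swap) (simp add: mult.commute)

text \<open>The form of U at g is the squared length of the combination of the vectors
  \<open>V j\<close> with coefficients g. If U g = 0, the form vanishes and hence so does the
  combination. The statement for \<open>cnj_mat U\<close> follows by passing to
  \<open>cnj_vec g\<close>.\<close>

lemma nonneg_hermitian_gram:
  fixes V :: "'n::finite \<Rightarrow> nat \<Rightarrow> complex"
  assumes U: "\<And>j k. U $ j $ k = (\<Sum>i<m. V k i * cnj (V j i))"
  shows "nonneg_hermitian U"
    and "U *v g = 0 \<longleftrightarrow> (\<forall>i<m. (\<Sum>j\<in>UNIV. g $ j * V j i) = 0)"
    and "cnj_mat U *v g = 0 \<longleftrightarrow> (\<forall>i<m. (\<Sum>j\<in>UNIV. g $ j * cnj (V j i)) = 0)"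
proof -
  have form: "(\<Sum>j\<in>UNIV. \<Sum>k\<in>UNIV. cnj (x $ j) * U $ j $ k * x $ k) =
    of_real (\<Sum>i<m. (cmod (\<Sum>j\<in>UNIV. x $ j * V j i))\<^sup>2)" for x
  proof -
    have "(\<Sum>j\<in>UNIV. \<Sum>k\<in>UNIV. cnj (x $ j) * U $ j $ k * x $ k) =
      (\<Sum>i<m. \<Sum>j\<in>UNIV. \<Sum>k\<in>UNIV. cnj (x $ j * V j i) * (x $ k * V k i))"
      by (simp add: U sum_distrib_left sum_distrib_right mult_ac sum.swap[of _ "{..<m}"])
    then show ?thesis
      by (simp only: cmod_sum_square of_real_sum)
  qed
  show "nonneg_hermitian U"
    unfolding nonneg_hermitian_def hermitian_matrix_def form
    by (auto simp: U mult.commute intro!: sum_nonneg)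
  have ker: "U *v g = 0 \<longleftrightarrow> (\<forall>i<m. (\<Sum>j\<in>UNIV. g $ j * V j i) = 0)" for g
  proof
    assume "U *v g = 0"
    then have "(\<Sum>k\<in>UNIV. U $ j $ k * g $ k) = 0" for j
      by (simp only: Finite_Cartesian_Product.vec_eq_iff matrix_vector_mult_def vec_lambda_beta zero_index)
    then have "(\<Sum>j\<in>UNIV. \<Sum>k\<in>UNIV. cnj (g $ j) * U $ j $ k * g $ k) = 0"
      by (simp add: mult.assoc flip: sum_distrib_left)
    then have "(\<Sum>i<m. (cmod (\<Sum>j\<in>UNIV. g $ j * V j i))\<^sup>2) = 0"
      unfolding form of_real_eq_0_iff .
    then show "\<forall>i<m. (\<Sum>j\<in>UNIV. g $ j * V j i) = 0"
      by (simp add: sum_nonneg_eq_0_iff)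
  next
    assume *: "\<forall>i<m. (\<Sum>j\<in>UNIV. g $ j * V j i) = 0"
    have "(\<Sum>k\<in>UNIV. U $ j $ k * g $ k) = (\<Sum>i<m. cnj (V j i) * (\<Sum>k\<in>UNIV. g $ k * V k i))" for j
      by (simp add: U sum_distrib_left sum_distrib_right mult_ac sum.swap[of _ "{..<m}"])
    then show "U *v g = 0"
      using * by (simp add: Finite_Cartesian_Product.vec_eq_iff matrix_vector_mult_def)
  qed
  then show "U *v g = 0 \<longleftrightarrow> (\<forall>i<m. (\<Sum>j\<in>UNIV. g $ j * V j i) = 0)" .
  have "cnj_mat U *v g = cnj_vec (U *v cnj_vec g)"
    by (simp add: cnj_mat_def cnj_vec_def Finite_Cartesian_Product.vec_eq_iff matrix_vector_mult_def)
  then have "cnj_mat U *v g = 0 \<longleftrightarrow> U *v cnj_vec g = 0"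
    by (simp add: cnj_vec_def Finite_Cartesian_Product.vec_eq_iff)
  also have "\<dots> \<longleftrightarrow> (\<forall>i<m. cnj (\<Sum>j\<in>UNIV. g $ j * cnj (V j i)) = 0)"
    by (simp add: ker cnj_vec_def del: complex_cnj_zero_iff)
  finally show "cnj_mat U *v g = 0 \<longleftrightarrow> (\<forall>i<m. (\<Sum>j\<in>UNIV. g $ j * cnj (V j i)) = 0)"
    by (simp only: complex_cnj_zero_iff)
qed

section \<open>Existence of a Gram factorization\<close>

definition herm_form :: "complex^'n^'n \<Rightarrow> complex^'n \<Rightarrow> complex" where
  "herm_form U x = (\<Sum>j\<in>UNIV. \<Sum>k\<in>UNIV. cnj (x $ j) * U $ j $ k * x $ k)"

text \<open>Along a coordinate direction the form is quadratic in \<open>t\<close>. If the diagonal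
  entry is zero, the linear term can be made to dominate; if it is positive, the best
  \<open>t\<close> is the minimizer, which leads to the Schur complement.\<close>

lemma herm_form_shift:
  assumes "hermitian_matrix U"
  shows "Re (herm_form U (x + axis p t)) =
    Re (herm_form U x) + 2 * Re (cnj t * (U *v x) $ p) + (cmod t)\<^sup>2 * Re (U $ p $ p)"
proof -
  have ax: "axis p t $ j = (if j = p then t else 0)" for j
    by (simp add: axis_def)
  have const_if: "(\<Sum>k\<in>UNIV. if j = p then g k else 0) = (if j = p then \<Sum>k\<in>UNIV. g k else 0)"
    for j and g :: "'a \<Rightarrow> complex"
    by simp
  have "herm_form U (x + axis p t) =
    herm_form U x + (\<Sum>j\<in>UNIV. cnj (x $ j) * U $ j $ p * t) + (\<Sum>k\<in>UNIV. cnj t * U $ p $ k * x $ k)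
     + cnj t * U $ p $ p * t"
    by (simp add: herm_form_def ax distrib_left distrib_right sum.distrib if_distrib[of cnj]
        if_distrib[of "\<lambda>t. _ * t"] if_distrib[of "\<lambda>t. t * _"] const_if cong: if_cong)
  moreover have "(\<Sum>k\<in>UNIV. cnj t * U $ p $ k * x $ k) = cnj t * (U *v x) $ p"
    by (simp add: matrix_vector_mult_def sum_distrib_left mult.assoc)
  moreover have "cnj (x $ j) * U $ j $ p * t = cnj (cnj t * (U $ p $ j * x $ j))" for j
  proof -
    have "U $ j $ p = cnj (U $ p $ j)" using assms unfolding hermitian_matrix_def by blast
    then show ?thesis by simp
  qed
  then have "(\<Sum>j\<in>UNIV. cnj (x $ j) * U $ j $ p * t) = cnj (cnj t * (U *v x) $ p)"
    by (simp only: cnj_sum[symmetric] matrix_vector_mult_def vec_lambda_beta sum_distrib_left)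
  moreover have "cnj t * U $ p $ p * t = of_real ((cmod t)\<^sup>2) * U $ p $ p"
    unfolding complex_norm_square by (simp add: mult_ac)
  ultimately show ?thesis
    by simp
qed

lemma nonneg_hermitian_zero_row:
  assumes U: "nonneg_hermitian U" and zero: "U $ p $ p = 0"
  shows "U $ p $ k = 0"
proof -
  have herm: "hermitian_matrix U" and pos: "0 \<le> Re (herm_form U x)" for x
    using U by (auto simp: nonneg_hermitian_def herm_form_def)
  define z where "z = U $ p $ k"
  have Uk: "(U *v axis k 1) $ p = z"
    by (simp add: matrix_vector_mult_def axis_def z_def if_distrib[of "\<lambda>t. _ * t"] cong: if_cong)
  show ?thesis
  proof (rule ccontr)
    assume "U $ p $ k \<noteq> 0"
    define Q where "Q = Re (herm_form U (axis k 1))"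
    \<comment> \<open>The quadratic term is absent, so this choice gives the form the value
      \<open>Q - 2 * (Q + 1)\<close>, which is negative because \<open>Q \<ge> 0\<close>.\<close>
    define s where "s = (Q + 1) / (cmod z)\<^sup>2"
    have z: "(cmod z)\<^sup>2 > 0" using \<open>U $ p $ k \<noteq> 0\<close> by (simp add: z_def)
    have "0 \<le> Q + 2 * Re (cnj (- of_real s * z) * z)"
      using pos[of "axis k 1 + axis p (- of_real s * z)"]
      by (simp only: herm_form_shift[OF herm] zero Uk Q_def) simp
    moreover have "Re (cnj (- of_real s * z) * z) = - s * (cmod z)\<^sup>2"
      unfolding cmod_power2 by (simp add: power2_eq_square algebra_simps)
    moreover have "s * (cmod z)\<^sup>2 = Q + 1"
      using z by (simp add: s_def)
    moreover have "Q \<ge> 0"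
      using pos by (simp add: Q_def)
    ultimately show False by simp
  qed
qed

text \<open>Induction on the support of U: a Schur complement removes one row and column.\<close>

lemma gram_decomposition:
  fixes U :: "complex^'n::finite^'n"
  assumes "nonneg_hermitian U"
  shows "\<exists>m (V :: 'n \<Rightarrow> nat \<Rightarrow> complex). \<forall>j k. U $ j $ k = (\<Sum>i<m. V k i * cnj (V j i))"
proof -
  have "\<exists>m (V :: 'n \<Rightarrow> nat \<Rightarrow> complex). \<forall>j k. U $ j $ k = (\<Sum>i<m. V k i * cnj (V j i))"
    if "finite A" "nonneg_hermitian U" "\<And>j k. j \<notin> A \<or> k \<notin> A \<Longrightarrow> U $ j $ k = 0"
    for A and U :: "complex^'n^'n"
    using that
  proof (induction A arbitrary: U rule: finite_induct)
    case empty
    then show ?case by (intro exI[of _ 0]) simp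
  next
    case (insert p A)
    note U = \<open>nonneg_hermitian U\<close>
    have herm: "hermitian_matrix U" and pos: "0 \<le> Re (herm_form U x)" for x
      using U by (auto simp: nonneg_hermitian_def herm_form_def)
    have sym: "U $ j $ k = cnj (U $ k $ j)" for j k
      using herm unfolding hermitian_matrix_def by blast
    show ?case
    proof (cases "U $ p $ p = 0")
      case True
      have "U $ p $ k = 0" "U $ k $ p = 0" for k
        using nonneg_hermitian_zero_row[OF U True, of k] sym[of k p] by auto
      then show ?thesis
        using insert.prems(2) by (intro insert.IH[OF U]) (metis insertE)
    next
      case False
      define d where "d = Re (U $ p $ p)"
      have d: "U $ p $ p = of_real d"
        using arg_cong[OF sym[of p p], of Im] by (simp add: d_def complex_eq_iff)
      have "herm_form U (axis p 1) = of_real d"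
        by (simp add: herm_form_def axis_def d if_distrib[of cnj] if_distrib[of "\<lambda>t. _ * t"]
            if_distrib[of "\<lambda>t. t * _"] cong: if_cong)
      then have dpos: "d > 0"
        using False d pos[of "axis p 1"] by (cases "d = 0") auto
      define U' :: "complex^'n^'n" where
        "U' = (\<chi> j k. U $ j $ k - U $ j $ p * U $ p $ k / of_real d)"
      have "0 \<le> Re (herm_form U' x)" for x
      proof -
        define s where "s = (U *v x) $ p"
        have row: "(\<Sum>k\<in>UNIV. U $ p $ k * x $ k) = s"
          by (simp add: s_def matrix_vector_mult_def)
        have col: "(\<Sum>j\<in>UNIV. cnj (x $ j) * U $ j $ p) = cnj s"
        proof -
          have "cnj (x $ j) * U $ j $ p = cnj (U $ p $ j * x $ j)" for j
            using sym[of j p] by simp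
          then show ?thesis by (simp only: cnj_sum[symmetric] row)
        qed
        have "herm_form U' x = herm_form U x -
          (\<Sum>j\<in>UNIV. \<Sum>k\<in>UNIV. (cnj (x $ j) * U $ j $ p) * (U $ p $ k * x $ k)) / of_real d"
          by (simp add: herm_form_def U'_def algebra_simps sum_subtractf sum_divide_distrib)
        also have "\<dots> = herm_form U x - of_real ((cmod s)\<^sup>2 / d)"
          unfolding sum_product[symmetric] row col of_real_divide complex_norm_square
          by (simp add: mult.commute)
        finally have "Re (herm_form U' x) = Re (herm_form U x) - (cmod s)\<^sup>2 / d"
          by simp
        \<comment> \<open>The shift \<open>- s / d\<close> minimizes the form of U in the direction
          p, and the minimum is the form of the Schur complement at x. Thus U' inherits
          nonnegativity.\<close>
        moreover have "Re (herm_form U (x + axis p (- s / of_real d))) =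
          Re (herm_form U x) - (cmod s)\<^sup>2 / d"
        proof -
          have e1: "Re (cnj (- s / of_real d) * s) = - ((cmod s)\<^sup>2 / d)"
            unfolding cmod_power2 by (simp add: power2_eq_square add_divide_distrib)
          have e2: "(cmod (- s / of_real d))\<^sup>2 * d = (cmod s)\<^sup>2 / d"
            using dpos by (simp add: norm_divide power2_eq_square)
          show ?thesis
            unfolding herm_form_shift[OF herm] s_def[symmetric] d_def[symmetric] e1 e2 by simp
        qed
        ultimately show ?thesis using pos[of "x + axis p (- s / of_real d)"] by simp
      qed
      moreover have "U' $ j $ k = cnj (U' $ k $ j)" for j k
        unfolding U'_def vec_lambda_beta complex_cnj_diff complex_cnj_divide complex_cnj_mult
          complex_cnj_complex_of_real sym[symmetric] by (simp add: mult.commute)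
      then have "hermitian_matrix U'"
        unfolding hermitian_matrix_def by blast
      ultimately have "nonneg_hermitian U'"
        by (simp add: nonneg_hermitian_def herm_form_def)
      moreover have "U' $ j $ k = 0" if "j \<notin> A \<or> k \<notin> A" for j k
        using that insert.prems(2)[of j k] insert.prems(2)[of j p] insert.prems(2)[of p k] dpos
        by (cases "j = p"; cases "k = p") (auto simp: U'_def d)
      ultimately obtain m and V :: "'n \<Rightarrow> nat \<Rightarrow> complex"
        where V: "\<And>j k. U' $ j $ k = (\<Sum>i<m. V k i * cnj (V j i))"
        using insert.IH by blast
      \<comment> \<open>One further coordinate restores the rank-one matrix that was subtracted in
        \<open>U'\<close>; the factor 1 / d is split evenly between the two sides, whence
        \<open>sqrt d\<close>.\<close>
      define W where "W k i = (if i = m then U $ p $ k / of_real (sqrt d) else V k i)" for k i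
      have "U $ j $ k = (\<Sum>i<Suc m. W k i * cnj (W j i))" for j k
      proof -
        have "(\<Sum>i<m. W k i * cnj (W j i)) = U' $ j $ k"
          by (simp add: V W_def)
        moreover have "W k m * cnj (W j m) = U $ j $ p * U $ p $ k / of_real d"
          using dpos sym[of j p]
          by (simp add: W_def mult.commute flip: of_real_mult)
        ultimately show ?thesis by (simp add: U'_def)
      qed
      then show ?thesis by blast
    qed
  qed
  from this[of UNIV U] assms show ?thesis by simp
qed

section \<open>Joint eigenvectors\<close>

definition joint_eigenspace :: "nat \<Rightarrow> ('n \<Rightarrow> complex mat) \<Rightarrow> complex^'n \<Rightarrow> complex vec set" where
  "joint_eigenspace m T a = {x \<in> carrier_vec m. \<forall>j. T j *\<^sub>v x = a $ j \<cdot>\<^sub>v x}"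

text \<open>The span of the joint eigenvectors with eigenvalues in \<open>F\<close>. The set
  \<open>F\<close> is kept as a parameter because eigenvalues are later removed from it one at a
  time.\<close>

inductive_set eigen_sums :: "nat \<Rightarrow> ('n \<Rightarrow> complex mat) \<Rightarrow> (complex^'n) set \<Rightarrow> complex vec set"
  for m :: nat and T :: "'n \<Rightarrow> complex mat" and F :: "(complex^'n) set" where
  zero: "0\<^sub>v m \<in> eigen_sums m T F"
| add: "x \<in> eigen_sums m T F \<Longrightarrow> a \<in> F \<Longrightarrow> y \<in> joint_eigenspace m T a \<Longrightarrow> x + y \<in> eigen_sums m T F"

lemma eigen_sums_carrier: "x \<in> eigen_sums m T F \<Longrightarrow> x \<in> carrier_vec m"
  by (induction rule: eigen_sums.induct) (auto simp: joint_eigenspace_def)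

lemma eigen_sums_mono: "x \<in> eigen_sums m T F \<Longrightarrow> F \<subseteq> G \<Longrightarrow> x \<in> eigen_sums m T G"
  by (induction rule: eigen_sums.induct) (auto intro: eigen_sums.intros)

lemma joint_eigenspace_sums: "x \<in> joint_eigenspace m T a \<Longrightarrow> a \<in> F \<Longrightarrow> x \<in> eigen_sums m T F"
  using eigen_sums.add[OF eigen_sums.zero, of a F x m T] by (simp add: joint_eigenspace_def)

lemma eigen_sums_add:
  assumes x: "x \<in> eigen_sums m T F"
  shows "y \<in> eigen_sums m T F \<Longrightarrow> x + y \<in> eigen_sums m T F"
proof (induction rule: eigen_sums.induct)
  case zero
  then show ?case using x eigen_sums_carrier[OF x] by simp
next
  case (add y a z)
  have "x + (y + z) = (x + y) + z"
    using eigen_sums_carrier[OF x] eigen_sums_carrier[OF add.hyps(1)] add.hyps(3)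
    by (simp add: assoc_add_vec[of _ m] joint_eigenspace_def)
  then show ?case using add by (simp add: eigen_sums.add)
qed

lemma joint_eigenspace_smult:
  assumes T: "\<And>k. T k \<in> carrier_mat m m" and y: "y \<in> joint_eigenspace m T a"
  shows "c \<cdot>\<^sub>v y \<in> joint_eigenspace m T a"
  using y by (auto simp: joint_eigenspace_def mult_mat_vec[OF T] smult_smult_assoc mult.commute)

lemma joint_eigenspace_add:
  assumes T: "\<And>k. T k \<in> carrier_mat m m"
    and "x \<in> joint_eigenspace m T a" "y \<in> joint_eigenspace m T a"
  shows "x + y \<in> joint_eigenspace m T a"
  using assms(2,3)
  by (auto simp: joint_eigenspace_def mult_add_distrib_mat_vec[OF T] smult_add_distrib_vec[of _ m])

lemma eigen_sums_smult:
  assumes T: "\<And>k. T k \<in> carrier_mat m m"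
  shows "x \<in> eigen_sums m T F \<Longrightarrow> c \<cdot>\<^sub>v x \<in> eigen_sums m T F"
proof (induction rule: eigen_sums.induct)
  case zero
  have "c \<cdot>\<^sub>v 0\<^sub>v m = 0\<^sub>v m" by (intro eq_vecI) auto
  then show ?case by (simp add: eigen_sums.zero)
next
  case (add x a y)
  have "c \<cdot>\<^sub>v (x + y) = c \<cdot>\<^sub>v x + c \<cdot>\<^sub>v y"
    using eigen_sums_carrier[OF add.hyps(1)] add.hyps(3)
    by (simp add: smult_add_distrib_vec[of _ m] joint_eigenspace_def)
  then show ?case using add joint_eigenspace_smult[OF T add.hyps(3)] by (simp add: eigen_sums.add)
qed

lemma eigen_sums_minus:
  assumes T: "\<And>k. T k \<in> carrier_mat m m" and "x \<in> eigen_sums m T F" "y \<in> eigen_sums m T F"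
  shows "x - y \<in> eigen_sums m T F"
proof -
  have "x - y = x + (- 1) \<cdot>\<^sub>v y"
    using eigen_sums_carrier[OF assms(2)] eigen_sums_carrier[OF assms(3)] by auto
  then show ?thesis using eigen_sums_add[OF assms(2) eigen_sums_smult[OF T assms(3)]] by simp
qed

lemma eigen_sums_finite:
  "x \<in> eigen_sums m T F \<Longrightarrow> \<exists>G. finite G \<and> x \<in> eigen_sums m T G"
proof (induction rule: eigen_sums.induct)
  case zero
  then show ?case using eigen_sums.zero by blast
next
  case (add x a y)
  then obtain G where "finite G" "x \<in> eigen_sums m T G" by auto
  then have "finite (insert a G)" "x + y \<in> eigen_sums m T (insert a G)"
    using add.hyps eigen_sums_mono[of x m T G "insert a G"] by (auto intro: eigen_sums.add)
  then show ?case by blast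
qed

lemma eigen_sums_singleton:
  assumes T: "\<And>k. T k \<in> carrier_mat m m"
  shows "x \<in> eigen_sums m T {a} \<Longrightarrow> x \<in> joint_eigenspace m T a"
proof (induction rule: eigen_sums.induct)
  case zero
  have "T j *\<^sub>v 0\<^sub>v m = 0\<^sub>v m" for j
    using T[of j] by auto
  moreover have "a $ j \<cdot>\<^sub>v 0\<^sub>v m = 0\<^sub>v m" for j
    by (intro eq_vecI) auto
  ultimately show ?case by (simp add: joint_eigenspace_def)
next
  case (add x b y)
  then show ?case using joint_eigenspace_add[OF T] by auto
qed

section \<open>Eigenvectors modulo the span of the joint eigenvectors\<close>

definition shifted :: "complex mat \<Rightarrow> complex \<Rightarrow> complex vec \<Rightarrow> complex vec" where
  "shifted A s x = A *\<^sub>v x - s \<cdot>\<^sub>v x"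

lemma shifted_carrier:
  "A \<in> carrier_mat m m \<Longrightarrow> x \<in> carrier_vec m \<Longrightarrow> shifted A s x \<in> carrier_vec m"
  unfolding shifted_def by (intro minus_carrier_vec mult_mat_vec_carrier smult_carrier_vec) auto

lemma shifted_add:
  assumes "A \<in> carrier_mat m m" "x \<in> carrier_vec m" "y \<in> carrier_vec m"
  shows "shifted A s (x + y) = shifted A s x + shifted A s y"
  using assms unfolding shifted_def
  by (intro eq_vecI)
    (simp_all add: mult_add_distrib_mat_vec[OF assms] algebra_simps del: index_mult_mat_vec)

lemma shifted_commute:
  assumes A: "A \<in> carrier_mat m m" and B: "B \<in> carrier_mat m m" and AB: "A * B = B * A"
    and x: "x \<in> carrier_vec m"
  shows "shifted A s (shifted B r x) = shifted B r (shifted A s x)"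
proof -
  have Bx: "B *\<^sub>v x \<in> carrier_vec m" and Ax: "A *\<^sub>v x \<in> carrier_vec m"
    using A B x by (auto intro!: mult_mat_vec_carrier)
  have ABx: "A *\<^sub>v (B *\<^sub>v x) = B *\<^sub>v (A *\<^sub>v x)"
    using AB assoc_mult_mat_vec[OF A B x] assoc_mult_mat_vec[OF B A x] by simp
  have "A *\<^sub>v (B *\<^sub>v x - r \<cdot>\<^sub>v x) = A *\<^sub>v (B *\<^sub>v x) - r \<cdot>\<^sub>v (A *\<^sub>v x)"
    using x Bx by (simp add: mult_minus_distrib_mat_vec[OF A] mult_mat_vec[OF A])
  moreover have "B *\<^sub>v (A *\<^sub>v x - s \<cdot>\<^sub>v x) = A *\<^sub>v (B *\<^sub>v x) - s \<cdot>\<^sub>v (B *\<^sub>v x)"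
    using x Ax by (simp add: mult_minus_distrib_mat_vec[OF B] mult_mat_vec[OF B] ABx)
  ultimately show ?thesis
    using A B x unfolding shifted_def
    by (intro eq_vecI) (simp_all add: algebra_simps del: index_mult_mat_vec)
qed

text \<open>The operator multiplies a component with eigenvalue a by \<open>a $ k - s\<close> and so
  deletes those with \<open>a $ k = s\<close>. This shows that the span is invariant and also serves
  to remove single eigenvalues.\<close>

lemma shifted_eigen_sums:
  assumes T: "\<And>k. T k \<in> carrier_mat m m"
  shows "x \<in> eigen_sums m T F \<Longrightarrow> shifted (T k) s x \<in> eigen_sums m T (F - {a. a $ k = s})"
proof (induction rule: eigen_sums.induct)
  case zero
  have "shifted (T k) s (0\<^sub>v m) = 0\<^sub>v m"
    unfolding shifted_def using T[of k] by auto
  then show ?case by (simp add: eigen_sums.zero)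
next
  case (add x a y)
  have y: "y \<in> carrier_vec m" "T k *\<^sub>v y = a $ k \<cdot>\<^sub>v y"
    using add.hyps by (auto simp: joint_eigenspace_def)
  have Ty: "shifted (T k) s y = (a $ k - s) \<cdot>\<^sub>v y"
    using y(1) unfolding shifted_def y(2) by (auto simp: algebra_simps)
  have "shifted (T k) s y \<in> eigen_sums m T (F - {a. a $ k = s})"
  proof (cases "a $ k = s")
    case True
    then have "shifted (T k) s y = 0\<^sub>v m" using y(1) Ty by auto
    then show ?thesis by (simp add: eigen_sums.zero)
  next
    case False
    then show ?thesis
      unfolding Ty using add.hyps by (intro joint_eigenspace_sums[OF joint_eigenspace_smult[OF T]]) auto
  qed
  then show ?case
    using add.IH y by (simp add: shifted_add[OF T eigen_sums_carrier[OF add.hyps(1)]] eigen_sums_add)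
qed

text \<open>
  If \<open>A\<close> has the diagonal entries \<open>b\<^sub>1, \<dots>, b\<^sub>m\<close> in a triangular form, then the product of all
  \<open>A - b\<^sub>i\<close> kills x. The proof applies these factors to x one by one and stops just before the result
  enters \<open>E\<close>.
\<close>

lemma exists_eigenvector_modulo:
  fixes A :: "complex mat"
  assumes A: "A \<in> carrier_mat m m" and zero: "0\<^sub>v m \<in> E"
    and W: "W \<subseteq> carrier_vec m" "\<And>x s. x \<in> W \<Longrightarrow> shifted A s x \<in> W"
    and x: "x \<in> W" "x \<notin> E"
  shows "\<exists>x\<in>W. x \<notin> E \<and> (\<exists>s. shifted A s x \<in> E)"
proof -
  obtain es where "char_poly A = (\<Prod>a\<leftarrow>es. [:- a, 1:])"
    using char_poly_factorized[OF A] by auto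
  then obtain B where "upper_triangular B" "similar_mat A B"
    using schur_decomposition_exists[OF A] by blast
  then obtain P Q where wit: "similar_mat_wit A B P Q"
    by (auto simp: similar_mat_def)
  note w = similar_mat_witD2[OF A wit]
  have car: "B \<in> carrier_mat m m" "P \<in> carrier_mat m m" "Q \<in> carrier_mat m m"
    and PQ: "P * Q = 1\<^sub>m m" "Q * P = 1\<^sub>m m" and APBQ: "A = P * B * Q"
    using w by auto
  have QA: "Q *\<^sub>v (A *\<^sub>v x) = B *\<^sub>v (Q *\<^sub>v x)" if x: "x \<in> carrier_vec m" for x
  proof -
    have "Q * A = (Q * P) * (B * Q)"
      using car by (simp add: APBQ assoc_mult_mat[of _ m m _ m _ m])
    then have "Q * A = B * Q" using car PQ by simp
    then show ?thesis
      using assoc_mult_mat_vec[OF car(3) A x] assoc_mult_mat_vec[OF car(1,3) x] by simp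
  qed
  \<comment> \<open>The induction measures x by its coordinates in the triangular basis, which
    vanish from index i on. For \<open>i = m\<close> this is no condition; for \<open>i = 0\<close>
    it gives x = 0, which lies in E. Shifting by the i-th diagonal entry of B lowers the bound by
    one.\<close>
  have "\<exists>x\<in>W. x \<notin> E \<and> (\<exists>s. shifted A s x \<in> E)"
    if "i \<le> m" "x \<in> W" "x \<notin> E" "\<And>l. i \<le> l \<Longrightarrow> l < m \<Longrightarrow> (Q *\<^sub>v x) $v l = 0" for i x
    using that
  proof (induction i arbitrary: x)
    case 0
    have xc: "x \<in> carrier_vec m" using 0 W by auto
    have "Q *\<^sub>v x = 0\<^sub>v m" using 0 car by (intro eq_vecI) auto
    then have "(P * Q) *\<^sub>v x = P *\<^sub>v 0\<^sub>v m"
      using assoc_mult_mat_vec[OF car(2,3) xc] by simp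
    then have "x = 0\<^sub>v m" using PQ xc car by auto
    then show ?case using 0 zero by simp
  next
    case (Suc i)
    have xc: "x \<in> carrier_vec m" using Suc.prems W by auto
    define s where "s = B $$ (i, i)"
    define y where "y = shifted A s x"
    show ?case
    proof (cases "y \<in> E")
      case True
      then show ?thesis using Suc.prems by (auto simp: y_def)
    next
      case False
      have Qx: "Q *\<^sub>v x \<in> carrier_vec m" using car xc by auto
      have Ax: "A *\<^sub>v x \<in> carrier_vec m" using A xc by auto
      have Qy: "Q *\<^sub>v y = B *\<^sub>v (Q *\<^sub>v x) - s \<cdot>\<^sub>v (Q *\<^sub>v x)"
        using Ax xc unfolding y_def shifted_def
        by (simp add: mult_minus_distrib_mat_vec[OF car(3)] mult_mat_vec[OF car(3)] QA)
      have "(Q *\<^sub>v y) $v l = 0" if l: "i \<le> l" "l < m" for l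
      proof -
        \<comment> \<open>B vanishes to the left of the diagonal and the coordinates of x vanish
          beyond i, so at most the diagonal term is left. For \<open>l = i\<close> the diagonal
          entry is \<open>s\<close>; for larger \<open>l\<close> both sides are zero.\<close>
        have "B $$ (l, q) * (Q *\<^sub>v x) $v q = (if q = l then s * (Q *\<^sub>v x) $v l else 0)"
          if q: "q < m" for q
        proof -
          consider "q < l" | "q = l" | "l < q" by linarith
          then show ?thesis
          proof cases
            case 1
            then show ?thesis using \<open>upper_triangular B\<close> car l by auto
          next
            case 2
            then show ?thesis
              using l Suc.prems(4)[of l] by (cases "l = i") (auto simp: s_def)
          next
            case 3
            then show ?thesis using Suc.prems(4)[of q] q l by auto
          qed
        qed
        then have "(B *\<^sub>v (Q *\<^sub>v x)) $v l = s * (Q *\<^sub>v x) $v l"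
          using l by (simp add: mult_mat_vec_sum[OF car(1) Qx] del: index_mult_mat_vec)
        then show ?thesis
          unfolding Qy using l car by (simp del: index_mult_mat_vec)
      qed
      then show ?thesis
        using Suc.prems False W(2)[of x s] by (intro Suc.IH[of y]) (auto simp: y_def)
    qed
  qed
  from this[of m x] x show ?thesis by simp
qed

text \<open>The indices are added one at a time. The vectors that satisfy the condition on
  \<open>J\<close> form a set invariant under the next operator, because shifted operators commute
  and map E into itself; so the result for a single operator applies inside this set.\<close>

lemma exists_joint_eigenvector_modulo:
  fixes T :: "'n::finite \<Rightarrow> complex mat"
  assumes T: "commuting_tuple m T" and zero: "0\<^sub>v m \<in> E"
    and E: "\<And>x k s. x \<in> E \<Longrightarrow> shifted (T k) s x \<in> E"
    and x: "x \<in> carrier_vec m" "x \<notin> E"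
  obtains y and c :: "complex^'n"
  where "y \<in> carrier_vec m" "y \<notin> E" "\<And>j. shifted (T j) (c $ j) y \<in> E"
proof -
  note car = commuting_tuple_carrier[OF T]
  have "\<exists>y c. y \<in> carrier_vec m \<and> y \<notin> E \<and> (\<forall>j\<in>J. shifted (T j) (c j) y \<in> E)" for J
    using finite[of J]
  proof (induction J rule: finite_induct)
    case empty
    then show ?case using x by auto
  next
    case (insert k J)
    then obtain y c where y: "y \<in> carrier_vec m" "y \<notin> E" "\<And>j. j \<in> J \<Longrightarrow> shifted (T j) (c j) y \<in> E"
      by auto
    let ?W = "{y \<in> carrier_vec m. \<forall>j\<in>J. shifted (T j) (c j) y \<in> E}"
    have "shifted (T k) s z \<in> ?W" if "z \<in> ?W" for s z
    proof -
      have "shifted (T j) (c j) (shifted (T k) s z) = shifted (T k) s (shifted (T j) (c j) z)" for j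
        using T that by (intro shifted_commute[of _ m]) (auto simp: commuting_tuple_def)
      then show ?thesis using that E shifted_carrier[OF car] by auto
    qed
    then obtain z s where z: "z \<in> ?W" "z \<notin> E" "shifted (T k) s z \<in> E"
      using exists_eigenvector_modulo[OF car zero, of ?W k y] y by blast
    then have "\<forall>j\<in>insert k J. shifted (T j) ((c(k := s)) j) z \<in> E"
      by auto
    then show ?case using z by blast
  qed
  from this[of UNIV] obtain y and c :: "'n \<Rightarrow> complex"
    where "y \<in> carrier_vec m" "y \<notin> E" "\<And>j. shifted (T j) (c j) y \<in> E"
    by auto
  then show thesis using that[of y "\<chi> j. c j"] by simp
qed

text \<open>
  A joint eigenvector x modulo the span E of all joint eigenvectors satisfies \<open>(T j - c j) x \<in> E\<close>.
  Applying \<open>T k - a k\<close> with \<open>a k \<noteq> c k\<close> removes the component of \<open>(T j - c j) x\<close> with eigenvalue a and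
  multiplies x by a nonzero scalar modulo E, so that finally only the eigenvalue c is left.
\<close>

lemma exists_first_order_jet:
  fixes T :: "'n::finite \<Rightarrow> complex mat"
  assumes T: "commuting_tuple m T" and ne: "\<not> carrier_vec m \<subseteq> eigen_sums m T UNIV"
  obtains c x u j where "first_order_jet m T c x u" "u j \<noteq> 0\<^sub>v m"
proof -
  note car = commuting_tuple_carrier[OF T]
  let ?E = "eigen_sums m T UNIV"
  have E: "shifted (T k) s x \<in> ?E" if "x \<in> ?E" for x k s
    using shifted_eigen_sums[where T = T, OF car that] by (rule eigen_sums_mono) simp
  from ne obtain x0 where "x0 \<in> carrier_vec m" "x0 \<notin> ?E" by auto
  then obtain x1 and c :: "complex^'n" where x1: "x1 \<in> carrier_vec m" "x1 \<notin> ?E"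
    and E1: "\<And>j. shifted (T j) (c $ j) x1 \<in> ?E"
    using exists_joint_eigenvector_modulo[OF T eigen_sums.zero E] by blast
  have "\<exists>x\<in>carrier_vec m. x \<notin> ?E \<and> (\<forall>j. shifted (T j) (c $ j) x \<in> eigen_sums m T {c})"
    if "finite F" "x \<in> carrier_vec m" "x \<notin> ?E" "\<And>j. shifted (T j) (c $ j) x \<in> eigen_sums m T (insert c F)"
    for F x
    using that
  proof (induction F arbitrary: x rule: finite_induct)
    case empty
    then show ?case by blast
  next
    case (insert a F)
    show ?case
    proof (cases "a = c")
      case True
      then show ?thesis using insert.prems by (intro insert.IH[of x]) auto
    next
      case False
      then obtain k where k: "a $ k \<noteq> c $ k"
        by (auto simp: Finite_Cartesian_Product.vec_eq_iff)
      define y where "y = shifted (T k) (a $ k) x"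
      have "y \<notin> ?E"
      proof
        assume "y \<in> ?E"
        moreover have "shifted (T k) (c $ k) x \<in> ?E"
          using insert.prems(3)[of k] by (rule eigen_sums_mono) simp
        ultimately have "inverse (a $ k - c $ k) \<cdot>\<^sub>v (shifted (T k) (c $ k) x - y) \<in> ?E"
          by (intro eigen_sums_smult[OF car] eigen_sums_minus[OF car])
        moreover have "inverse (a $ k - c $ k) \<cdot>\<^sub>v (shifted (T k) (c $ k) x - y) = x"
          using insert.prems(1) carrier_matD[OF car[of k]] k unfolding y_def shifted_def
          by (intro eq_vecI) (simp_all add: field_simps del: index_mult_mat_vec)
        ultimately show False using insert.prems(2) by simp
      qed
      moreover have "shifted (T j) (c $ j) y \<in> eigen_sums m T (insert c F)" for j
      proof -
        have "shifted (T j) (c $ j) y = shifted (T k) (a $ k) (shifted (T j) (c $ j) x)"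
          unfolding y_def
          using T insert.prems(1) by (intro shifted_commute[of _ m]) (auto simp: commuting_tuple_def)
        moreover have "shifted (T k) (a $ k) (shifted (T j) (c $ j) x) \<in>
          eigen_sums m T (insert c (insert a F) - {b. b $ k = a $ k})"
          using insert.prems(3) by (rule shifted_eigen_sums[OF car])
        ultimately show ?thesis by (auto intro: eigen_sums_mono)
      qed
      ultimately show ?thesis
        using shifted_carrier[OF car insert.prems(1)] by (intro insert.IH[of y]) (auto simp: y_def)
    qed
  qed
  \<comment> \<open>Each of the finitely many vectors \<open>shifted (T j) (c $ j) x1\<close>
    involves finitely many eigenvalues, so one finite set serves them all and the induction can
    start.\<close>
  moreover have "\<exists>F. finite F \<and> (\<forall>j. shifted (T j) (c $ j) x1 \<in> eigen_sums m T F)"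
  proof -
    have "\<forall>j. \<exists>G. finite G \<and> shifted (T j) (c $ j) x1 \<in> eigen_sums m T G"
      using eigen_sums_finite[OF E1] by blast
    then obtain G where "\<forall>j. finite (G j) \<and> shifted (T j) (c $ j) x1 \<in> eigen_sums m T (G j)"
      by metis
    then show ?thesis
      by (intro exI[of _ "\<Union>j. G j"]) (auto intro: eigen_sums_mono)
  qed
  then obtain F where "finite F" "\<And>j. shifted (T j) (c $ j) x1 \<in> eigen_sums m T F" by auto
  then have "finite F" "\<And>j. shifted (T j) (c $ j) x1 \<in> eigen_sums m T (insert c F)"
    by (auto intro: eigen_sums_mono)
  ultimately obtain x where x: "x \<in> carrier_vec m" "x \<notin> ?E"
    and "\<And>j. shifted (T j) (c $ j) x \<in> eigen_sums m T {c}"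
    using x1 by blast
  then have u: "shifted (T j) (c $ j) x \<in> joint_eigenspace m T c" for j
    using eigen_sums_singleton[where T = T, OF car] by blast
  have Tx: "T j *\<^sub>v x = c $ j \<cdot>\<^sub>v x + shifted (T j) (c $ j) x" for j
    using x carrier_matD[OF car[of j]] unfolding shifted_def
    by (intro eq_vecI) (simp_all del: index_mult_mat_vec)
  have jet: "first_order_jet m T c x (\<lambda>j. shifted (T j) (c $ j) x)"
    using x u Tx by (auto simp: first_order_jet_def joint_eigenspace_def)
  have "\<exists>j. shifted (T j) (c $ j) x \<noteq> 0\<^sub>v m"
  proof (rule ccontr)
    assume "\<not> ?thesis"
    then have "T j *\<^sub>v x = c $ j \<cdot>\<^sub>v x" for j
      using Tx[of j] x by simp
    then have "x \<in> joint_eigenspace m T c" using x by (simp add: joint_eigenspace_def)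
    then show False using joint_eigenspace_sums x by blast
  qed
  then show thesis using that jet by blast
qed

section \<open>Kernels of commuting tuples\<close>

lemma joint_eigenspace_carrier: "x \<in> joint_eigenspace m T a \<Longrightarrow> x \<in> carrier_vec m"
  by (simp add: joint_eigenspace_def)

lemma mult_mat_zero_vec:
  assumes "A \<in> carrier_mat m m"
  shows "A *\<^sub>v 0\<^sub>v m = 0\<^sub>v m"
  using assms by auto

lemma smult_zero_vec: "(c :: complex) \<cdot>\<^sub>v 0\<^sub>v m = 0\<^sub>v m"
  by (intro eq_vecI) auto

lemma eigenvector_jet:
  assumes T: "\<And>k. T k \<in> carrier_mat m m" and x: "x \<in> joint_eigenspace m T a"
  shows "first_order_jet m T a x (\<lambda>_. 0\<^sub>v m)"
  using x by (simp add: first_order_jet_def joint_eigenspace_def mult_mat_zero_vec[OF T] smult_zero_vec)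

lemma zero_cscalar_prod:
  fixes x :: "complex vec"
  assumes "x \<in> carrier_vec m"
  shows "0\<^sub>v m \<bullet>c x = 0" "x \<bullet>c 0\<^sub>v m = 0"
  using assms by (simp_all add: cscalar_prod_sum[of _ m])

lemma hereditary_eigenvectors:
  fixes T :: "'n::finite \<Rightarrow> complex mat"
  assumes T: "commuting_tuple m T"
    and x: "x \<in> joint_eigenspace m T a" and y: "y \<in> joint_eigenspace m T b"
  shows "(hereditary m T f *\<^sub>v x) \<bullet>c y = poly_subst f a (cnj_vec b) * (x \<bullet>c y)"
  using joint_eigenspace_carrier[OF x] joint_eigenspace_carrier[OF y]
  by (simp add: hereditary_jet[OF T eigenvector_jet[OF commuting_tuple_carrier[OF T] x]
        eigenvector_jet[OF commuting_tuple_carrier[OF T] y]] zero_cscalar_prod[of _ m])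

lemma mat_eq_if_vec_eq:
  fixes A B :: "complex mat"
  assumes A: "A \<in> carrier_mat m m" and B: "B \<in> carrier_mat m m"
    and eq: "\<And>x. x \<in> carrier_vec m \<Longrightarrow> A *\<^sub>v x = B *\<^sub>v x"
  shows "A = B"
proof (rule eq_matI)
  fix i j assume "i < dim_row B" "j < dim_col B"
  then have i: "i < m" and j: "j < m" using B by auto
  have "C $$ (i, j) = (C *\<^sub>v unit_vec m j) $v i" if C: "C \<in> carrier_mat m m" for C :: "complex mat"
    using i j by (simp add: mult_mat_vec_sum[OF C unit_vec_carrier i] if_distrib[of "\<lambda>t. _ * t"]
        del: index_mult_mat_vec cong: if_cong)
  then show "A $$ (i, j) = B $$ (i, j)" using A B eq by simp
qed (use A B in auto)

lemma mat_eq_zero_if_form_zero: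
  fixes A :: "complex mat"
  assumes A: "A \<in> carrier_mat m m"
    and zero: "\<And>x y. x \<in> carrier_vec m \<Longrightarrow> y \<in> carrier_vec m \<Longrightarrow> (A *\<^sub>v x) \<bullet>c y = 0"
  shows "A = 0\<^sub>m m m"
proof (rule mat_eq_if_vec_eq[OF A zero_carrier_mat])
  fix x :: "complex vec" assume x: "x \<in> carrier_vec m"
  then have Ax: "A *\<^sub>v x \<in> carrier_vec m" using A by auto
  then have "A *\<^sub>v x = 0\<^sub>v m" using zero[OF x Ax] conjugate_square_eq_0_vec[OF Ax] by simp
  then show "A *\<^sub>v x = 0\<^sub>m m m *\<^sub>v x" using x by auto
qed

text \<open>Let y be an eigenvector for a, and let w be the adjoint of T_j minus the conjugate of
  a_j, applied to y. Pairing w with an eigenvector e for b gives the conjugate of b_j - a_j times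
  the inner product of y and e, which is zero for a = b and, by orthogonality, for all other b. As
  the eigenvectors span, w = 0. So the adjoint acts on y by a scalar and commutes with T_j on a
  spanning set.\<close>

lemma normal_if_orthogonal_eigenspaces:
  fixes T :: "'n::finite \<Rightarrow> complex mat"
  assumes T: "commuting_tuple m T"
    and orth: "\<And>a b x y. a \<noteq> b \<Longrightarrow> x \<in> joint_eigenspace m T a \<Longrightarrow> y \<in> joint_eigenspace m T b \<Longrightarrow> x \<bullet>c y = 0"
    and span: "carrier_vec m \<subseteq> eigen_sums m T UNIV"
  shows "normal_tuple T"
proof -
  note car = commuting_tuple_carrier[OF T]
  note acar = mat_adjoint_carrier[OF car]
  have adj: "mat_adjoint (T j) *\<^sub>v y = cnj (a $ j) \<cdot>\<^sub>v y" if y: "y \<in> joint_eigenspace m T a" for j a y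
  proof -
    have yc: "y \<in> carrier_vec m" using y by (rule joint_eigenspace_carrier)
    define w where "w = shifted (mat_adjoint (T j)) (cnj (a $ j)) y"
    have wc: "w \<in> carrier_vec m" unfolding w_def by (rule shifted_carrier[OF acar yc])
    have "w \<bullet>c z = 0" if "z \<in> eigen_sums m T UNIV" for z
      using that
    proof (induction rule: eigen_sums.induct)
      case zero
      then show ?case using wc by (simp add: zero_cscalar_prod)
    next
      case (add z b e)
      have zc: "z \<in> carrier_vec m" and ec: "e \<in> carrier_vec m"
        using add.hyps eigen_sums_carrier joint_eigenspace_carrier by blast+
      have Te: "T j *\<^sub>v e = b $ j \<cdot>\<^sub>v e" using add.hyps by (simp add: joint_eigenspace_def)
      have ay: "mat_adjoint (T j) *\<^sub>v y \<in> carrier_vec m" using acar yc by (rule mult_mat_vec_carrier)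
      have "w \<bullet>c e = (mat_adjoint (T j) *\<^sub>v y) \<bullet>c e - cnj (a $ j) * (y \<bullet>c e)"
        using ay yc carrier_vecD[OF ay] unfolding w_def shifted_def
        by (simp add: cscalar_prod_sum[OF ec] algebra_simps sum_subtractf sum_distrib_left
            del: index_mult_mat_vec dim_mult_mat_vec)
      also have "(mat_adjoint (T j) *\<^sub>v y) \<bullet>c e = cnj (b $ j) * (y \<bullet>c e)"
        unfolding mat_adjoint_cscalar_prod[OF car yc ec] Te
        using ec yc by (simp add: cscalar_prod_sum[of _ m] sum_distrib_left mult_ac)
      finally have "w \<bullet>c e = 0"
        using orth[OF _ y add.hyps(3)] by (cases "a = b") auto
      moreover have "w \<bullet>c (z + e) = w \<bullet>c z + w \<bullet>c e"
        using zc ec by (simp add: cscalar_prod_sum[of _ m] algebra_simps sum.distrib)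
      ultimately show ?case using add.IH by simp
    qed
    then have "w \<bullet>c w = 0" using span wc by blast
    then have "w = 0\<^sub>v m" using conjugate_square_eq_0_vec[OF wc] by simp
    then have "(mat_adjoint (T j) *\<^sub>v y) $v i = (cnj (a $ j) \<cdot>\<^sub>v y) $v i" if "i < m" for i
    proof -
      have "w $v i = 0" using \<open>w = 0\<^sub>v m\<close> that by simp
      then show ?thesis
        using that yc unfolding w_def shifted_def by (simp del: index_mult_mat_vec)
    qed
    then show ?thesis
      using yc carrier_matD[OF acar[of j]] by (intro eq_vecI) (auto simp del: index_mult_mat_vec)
  qed
  have "T j * mat_adjoint (T j) = mat_adjoint (T j) * T j" for j
  proof (rule mat_eq_if_vec_eq[of _ m])
    fix x :: "complex vec" assume "x \<in> carrier_vec m"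
    then have "x \<in> eigen_sums m T UNIV" using span by blast
    then have "T j *\<^sub>v (mat_adjoint (T j) *\<^sub>v x) = mat_adjoint (T j) *\<^sub>v (T j *\<^sub>v x)"
    proof (induction rule: eigen_sums.induct)
      case zero
      then show ?case by (simp add: mult_mat_zero_vec[OF car] mult_mat_zero_vec[OF acar])
    next
      case (add x a y)
      have xc: "x \<in> carrier_vec m" and yc: "y \<in> carrier_vec m"
        using add.hyps eigen_sums_carrier joint_eigenspace_carrier by blast+
      have Ty: "T j *\<^sub>v y = a $ j \<cdot>\<^sub>v y" using add.hyps by (simp add: joint_eigenspace_def)
      have "T j *\<^sub>v (mat_adjoint (T j) *\<^sub>v y) = mat_adjoint (T j) *\<^sub>v (T j *\<^sub>v y)"
        by (simp add: adj[OF add.hyps(3)] Ty mult_mat_vec[OF car yc] mult_mat_vec[OF acar yc]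
            smult_smult_assoc mult.commute)
      then show ?case
        using add.IH mult_mat_vec_carrier[OF car xc] mult_mat_vec_carrier[OF car yc]
          mult_mat_vec_carrier[OF acar xc] mult_mat_vec_carrier[OF acar yc]
        by (simp add: mult_add_distrib_mat_vec[OF car] mult_add_distrib_mat_vec[OF acar] xc yc)
    qed
    then show "(T j * mat_adjoint (T j)) *\<^sub>v x = (mat_adjoint (T j) * T j) *\<^sub>v x"
      using \<open>x \<in> carrier_vec m\<close>
      by (simp add: assoc_mult_mat_vec[OF car acar] assoc_mult_mat_vec[OF acar car])
  qed (use mult_carrier_mat[OF car acar] mult_carrier_mat[OF acar car] in auto)
  then show ?thesis by (simp add: normal_tuple_def)
qed

section \<open>Kernels contained in I(a,b) or J(a,U)\<close>

lemma hereditary_kernel_form: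
  assumes f: "f \<in> hereditary_kernel m T" and "u \<in> carrier_vec m" "v \<in> carrier_vec m"
  shows "(hereditary m T f *\<^sub>v u) \<bullet>c v = 0"
proof -
  have "hereditary m T f *\<^sub>v u = 0\<^sub>v m"
    using f assms(2) unfolding hereditary_kernel_def by auto
  then show ?thesis using assms(3) by (simp add: zero_cscalar_prod)
qed

text \<open>The four pairings among x and y give the four values defining I(a,b), each multiplied by
  a nonzero inner product.\<close>

lemma kernel_subset_ideal_I:
  fixes T :: "'n::finite \<Rightarrow> complex mat"
  assumes T: "commuting_tuple m T"
    and x: "x \<in> joint_eigenspace m T a" and y: "y \<in> joint_eigenspace m T b" and xy: "x \<bullet>c y \<noteq> 0"
  shows "hereditary_kernel m T \<subseteq> ideal_I a b"
proof
  fix f assume "f \<in> hereditary_kernel m T"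
  note zero = hereditary_kernel_form[OF this]
  have xc: "x \<in> carrier_vec m" and yc: "y \<in> carrier_vec m"
    using x y by (auto intro: joint_eigenspace_carrier)
  have "y \<bullet>c x = cnj (x \<bullet>c y)"
    using xc yc by (simp add: cscalar_prod_sum[of _ m] mult.commute)
  then have yx: "y \<bullet>c x \<noteq> 0" using xy by simp
  have "x \<noteq> 0\<^sub>v m" "y \<noteq> 0\<^sub>v m"
    using xy xc yc by (auto simp: zero_cscalar_prod)
  then have "x \<bullet>c x \<noteq> 0" "y \<bullet>c y \<noteq> 0"
    using conjugate_square_eq_0_vec[OF xc] conjugate_square_eq_0_vec[OF yc] by auto
  then show "f \<in> ideal_I a b"
    using hereditary_eigenvectors[OF T x x, of f] hereditary_eigenvectors[OF T x y, of f]
      hereditary_eigenvectors[OF T y x, of f] hereditary_eigenvectors[OF T y y, of f]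
      xy yx zero xc yc
    by (simp add: ideal_I_def)
qed

lemma trace_mult:
  "trace (U ** H) = (\<Sum>j\<in>UNIV. \<Sum>k\<in>UNIV. H $ j $ k * U $ k $ j)" for U :: "complex^'n^'n"
  unfolding trace_def matrix_matrix_mult_def vec_lambda_beta
  by (subst sum.swap) (simp add: mult.commute)

text \<open>Each condition comes from one kind of pairing: \<open>u j0\<close> with itself gives the
  value, x with \<open>u k\<close> the z-gradient, \<open>u j\<close> with x the conjugate gradient,
  and x with itself the trace.\<close>

lemma kernel_subset_ideal_J:
  fixes T :: "'n::finite \<Rightarrow> complex mat"
  assumes T: "commuting_tuple m T" and jet: "first_order_jet m T a x u" and nz: "u j0 \<noteq> 0\<^sub>v m"
  shows "\<exists>U. nonneg_hermitian U \<and> U \<noteq> 0 \<and> hereditary_kernel m T \<subseteq> ideal_J a U"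
proof -
  have xc: "x \<in> carrier_vec m" and uc: "u j \<in> carrier_vec m" for j
    using jet by (auto simp: first_order_jet_def)
  have ue: "u j \<in> joint_eigenspace m T a" for j
    using jet by (auto simp: first_order_jet_def joint_eigenspace_def)
  note ujet = eigenvector_jet[OF commuting_tuple_carrier[OF T] ue]
  define U :: "complex^'n^'n" where "U = (\<chi> k j. u j \<bullet>c u k)"
  have U: "U $ k $ j = u j \<bullet>c u k" for j k by (simp add: U_def)
  have gram: "U $ k $ j = (\<Sum>i<m. u j $v i * cnj (u k $v i))" for j k
    by (simp add: U cscalar_prod_sum[OF uc])
  have unz: "u j0 \<bullet>c u j0 \<noteq> 0" using nz conjugate_square_eq_0_vec[OF uc] by simp
  have "U $ j0 $ j0 \<noteq> 0" by (simp add: U unz)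
  then have "U \<noteq> 0" by auto
  moreover have "nonneg_hermitian U"
    by (rule nonneg_hermitian_gram(1)[of U "\<lambda>j i. u j $v i" m, OF gram])
  moreover have "hereditary_kernel m T \<subseteq> ideal_J a U"
  proof
    fix f assume "f \<in> hereditary_kernel m T"
    note zero = hereditary_kernel_form[OF this]
    let ?g = "grad_z f a (cnj_vec a)" and ?h = "grad_zbar f a (cnj_vec a)"
    have f0: "poly_subst f a (cnj_vec a) = 0"
      using hereditary_eigenvectors[OF T ue ue, of f j0 j0] zero uc unz by simp
    have "(\<Sum>j\<in>UNIV. ?g $ j * (u j \<bullet>c u k)) = 0" for k
      using hereditary_jet[OF T jet ujet, of f k] zero xc uc
      by (simp add: f0 zero_cscalar_prod[of _ m])
    then have Ug: "U *v ?g = 0"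
      by (simp add: Finite_Cartesian_Product.vec_eq_iff matrix_vector_mult_def U mult.commute)
    have "(\<Sum>k\<in>UNIV. ?h $ k * (u j \<bullet>c u k)) = 0" for j
      using hereditary_jet[OF T ujet jet, of f j] zero xc uc
      by (simp add: f0 zero_cscalar_prod[of _ m])
    moreover have "cnj_mat U $ j $ k = u j \<bullet>c u k" for j k
      by (simp add: cnj_mat_def U cscalar_prod_sum[OF uc] mult.commute)
    ultimately have Uh: "cnj_mat U *v ?h = 0"
      by (simp add: Finite_Cartesian_Product.vec_eq_iff matrix_vector_mult_def mult.commute)
    \<comment> \<open>Here x need not lie in the span of the \<open>u j\<close>, so the pairings
      recorded in \<open>Ug\<close> do not suffice; the kernel property of Gram matrices shows that
      the combination of the \<open>u j\<close> itself vanishes.\<close>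
    have "(\<Sum>j\<in>UNIV. ?g $ j * (u j \<bullet>c x)) = (\<Sum>i<m. (\<Sum>j\<in>UNIV. ?g $ j * u j $v i) * cnj (x $v i))"
      by (simp add: cscalar_prod_sum[OF xc] sum_distrib_left sum_distrib_right
          sum.swap[of _ _ "{..<m}"] mult.assoc)
    also have "\<dots> = 0"
      using Ug nonneg_hermitian_gram(2)[of U "\<lambda>j i. u j $v i" m ?g, OF gram] by simp
    finally have g0: "(\<Sum>j\<in>UNIV. ?g $ j * (u j \<bullet>c x)) = 0" .
    have "(\<Sum>k\<in>UNIV. ?h $ k * (x \<bullet>c u k)) = (\<Sum>i<m. (\<Sum>k\<in>UNIV. ?h $ k * cnj (u k $v i)) * x $v i)"
      by (simp add: cscalar_prod_sum[OF uc] sum_distrib_left sum_distrib_right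
          sum.swap[of _ _ "{..<m}"] mult_ac)
    also have "\<dots> = 0"
      using Uh nonneg_hermitian_gram(3)[of U "\<lambda>j i. u j $v i" m ?h, OF gram] by simp
    finally have h0: "(\<Sum>k\<in>UNIV. ?h $ k * (x \<bullet>c u k)) = 0" .
    have "trace (U ** hess_z_zbar f a (cnj_vec a)) = 0"
      using hereditary_jet[OF T jet jet, of f] zero[OF xc xc]
      by (simp add: f0 g0 h0 trace_mult U)
    then show "f \<in> ideal_J a U"
      using f0 Ug Uh by (simp add: ideal_J_def)
  qed
  ultimately show ?thesis by blast
qed

section \<open>Non-normal model tuples\<close>

lemma ideal_I_subset_kernel:
  fixes a b :: "complex^'n::finite"
  assumes "a \<noteq> b"
  shows "\<exists>m (T :: 'n \<Rightarrow> complex mat).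
    commuting_tuple m T \<and> ideal_I a b \<subseteq> hereditary_kernel m T \<and> \<not> normal_tuple T"
proof -
  \<comment> \<open>The eigenvectors are to be (1,0) for \<open>a\<close> and (1,1) for
    \<open>b\<close>, which are not orthogonal; this forces the corner entry
    \<open>b $ j - a $ j\<close>.\<close>
  define T :: "'n \<Rightarrow> complex mat" where
    "T j = Matrix.mat 2 2 (\<lambda>(p, q). if p = 0 then (if q = 0 then a $ j else b $ j - a $ j)
       else (if q = 0 then 0 else b $ j))" for j
  define x y :: "complex vec" where "x = Matrix.vec 2 (\<lambda>p. if p = 0 then 1 else 0)"
    and "y = Matrix.vec 2 (\<lambda>p. 1)"
  have car: "T j \<in> carrier_mat 2 2" for j by (simp add: T_def)
  have xc: "x \<in> carrier_vec 2" and yc: "y \<in> carrier_vec 2" by (simp_all add: x_def y_def)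
  have two: "{..<2} = {0, 1 :: nat}" "{0..<2} = {0, 1 :: nat}" by auto
  have comm: "commuting_tuple 2 T"
    unfolding commuting_tuple_def
  proof (intro conjI allI car)
    fix j k show "T j * T k = T k * T j"
    proof (rule eq_matI)
      fix p q assume "p < dim_row (T k * T j)" "q < dim_col (T k * T j)"
      then have "p < 2" "q < 2" using carrier_matD[OF car] by auto
      then show "(T j * T k) $$ (p, q) = (T k * T j) $$ (p, q)"
        by (simp add: T_def scalar_prod_def two algebra_simps)
    qed (use carrier_matD[OF car] in simp_all)
  qed
  have Tv: "T j *\<^sub>v v = c \<cdot>\<^sub>v v"
    if v: "v \<in> carrier_vec 2" and "a $ j * v $v 0 + (b $ j - a $ j) * v $v 1 = c * v $v 0"
      "b $ j * v $v 1 = c * v $v 1" for j c v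
  proof (rule eq_vecI)
    fix p assume "p < dim_vec (c \<cdot>\<^sub>v v)"
    then have p: "p < 2" using v by simp
    then have "p = 0 \<or> p = 1" by auto
    then have "(\<Sum>l<2. T j $$ (p, l) * v $v l) = c * v $v p"
      using that(2,3) by (auto simp: two T_def)
    then show "(T j *\<^sub>v v) $v p = (c \<cdot>\<^sub>v v) $v p"
      using p v by (simp add: mult_mat_vec_sum[OF car v p] del: index_mult_mat_vec)
  qed (use v carrier_matD[OF car] in simp)
  have x: "x \<in> joint_eigenspace 2 T a" and y: "y \<in> joint_eigenspace 2 T b"
    using xc yc by (simp_all add: joint_eigenspace_def Tv x_def y_def)
  have "f \<in> hereditary_kernel 2 T" if f: "f \<in> ideal_I a b" for f
  proof -
    let ?H = "hereditary 2 T f"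
    have H: "?H \<in> carrier_mat 2 2" by (rule hereditary_carrier)
    \<comment> \<open>As x and y form a basis, the four pairings determine the matrix.\<close>
    have "(?H *\<^sub>v x) \<bullet>c x = 0" "(?H *\<^sub>v x) \<bullet>c y = 0" "(?H *\<^sub>v y) \<bullet>c x = 0" "(?H *\<^sub>v y) \<bullet>c y = 0"
      using f by (simp_all add: hereditary_eigenvectors[OF comm x x] hereditary_eigenvectors[OF comm x y]
          hereditary_eigenvectors[OF comm y x] hereditary_eigenvectors[OF comm y y] ideal_I_def)
    then have e: "?H $$ (0, 0) = 0" "?H $$ (0, 0) + ?H $$ (1, 0) = 0"
      "?H $$ (0, 0) + ?H $$ (0, 1) = 0"
      "?H $$ (0, 0) + ?H $$ (0, 1) + (?H $$ (1, 0) + ?H $$ (1, 1)) = 0"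
      by (simp_all add: cscalar_prod_sum[OF xc] cscalar_prod_sum[OF yc] mult_mat_vec_sum[OF H xc]
          mult_mat_vec_sum[OF H yc] two del: index_mult_mat_vec) (simp_all add: x_def y_def)
    have e': "?H $$ (1, 0) = 0" "?H $$ (0, 1) = 0"
      using e(2,3) unfolding e(1) by simp_all
    have e'': "?H $$ (1, 1) = 0"
      using e(4) unfolding e(1) e' by simp
    have "?H = 0\<^sub>m 2 2"
    proof (rule eq_matI)
      fix p q :: nat assume "p < dim_row (0\<^sub>m 2 2 :: complex mat)" "q < dim_col (0\<^sub>m 2 2 :: complex mat)"
      then have "p < 2" "q < 2" by simp_all
      then have "(p = 0 \<or> p = 1) \<and> (q = 0 \<or> q = 1)" by auto
      then show "?H $$ (p, q) = (0\<^sub>m 2 2) $$ (p, q)"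
        using e(1) e' e'' by (elim conjE disjE) simp_all
    qed (use H in auto)
    then show ?thesis by (simp add: hereditary_kernel_def)
  qed
  moreover have "\<not> normal_tuple T"
  proof
    assume normal: "normal_tuple T"
    \<comment> \<open>The (0,0) entries of the two products with the adjoint differ by the square of
      the modulus of \<open>b $ j - a $ j\<close>.\<close>
    have "a $ j = b $ j" for j
    proof -
      note acar = mat_adjoint_carrier[OF car[of j]]
      have "(T j * mat_adjoint (T j)) $$ (0, 0) = (mat_adjoint (T j) * T j) $$ (0, 0)"
        using normal by (simp add: normal_tuple_def)
      then have "(b $ j - a $ j) * cnj (b $ j - a $ j) = 0"
        using carrier_matD[OF acar] carrier_matD[OF car[of j]]
        by (simp add: scalar_prod_def two mat_adjoint_index[OF car]) (simp add: T_def mult.commute)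
      then show ?thesis by simp
    qed
    then show False using assms by (simp add: Finite_Cartesian_Product.vec_eq_iff)
  qed
  ultimately show ?thesis using comm by blast
qed

text \<open>On a jet, T_i T_l x equals a_i a_l x + a_l u_i + a_i u_l, which is symmetric in i and
  l.\<close>

lemma commuting_tuple_if_jets:
  fixes T :: "'n::finite \<Rightarrow> complex mat"
  assumes car: "\<And>j. T j \<in> carrier_mat m m"
    and jet: "\<And>x. x \<in> carrier_vec m \<Longrightarrow> \<exists>u. first_order_jet m T a x u"
  shows "commuting_tuple m T"
  unfolding commuting_tuple_def
proof (intro conjI allI car)
  fix j k show "T j * T k = T k * T j"
  proof (rule mat_eq_if_vec_eq[OF mult_carrier_mat[OF car car] mult_carrier_mat[OF car car]])
    fix x :: "complex vec" assume x: "x \<in> carrier_vec m"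
    then obtain u where u: "first_order_jet m T a x u" using jet by blast
    then have uc: "u i \<in> carrier_vec m" and Tx: "T i *\<^sub>v x = a $ i \<cdot>\<^sub>v x + u i"
      and Tu: "T l *\<^sub>v u i = a $ l \<cdot>\<^sub>v u i" for i l
      by (auto simp: first_order_jet_def)
    have "T i *\<^sub>v (T l *\<^sub>v x) = a $ l \<cdot>\<^sub>v (a $ i \<cdot>\<^sub>v x + u i) + a $ i \<cdot>\<^sub>v u l" for i l
      using x uc by (simp add: Tx Tu mult_add_distrib_mat_vec[OF car] mult_mat_vec[OF car])
    then have "T j *\<^sub>v (T k *\<^sub>v x) = T k *\<^sub>v (T j *\<^sub>v x)"
      using x uc[of j] uc[of k] by (auto simp: algebra_simps)
    then show "(T j * T k) *\<^sub>v x = (T k * T j) *\<^sub>v x"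
      using x by (simp add: assoc_mult_mat_vec[OF car car])
  qed
qed

text \<open>The tuple is built so that every vector is a jet, with increments proportional to the
  Gram vectors \<open>V j\<close>. The jet formula then computes the whole form, and the conditions
  of J(a,U) cancel its terms one by one.\<close>

lemma ideal_J_subset_kernel:
  fixes a :: "complex^'n::finite" and U :: "complex^'n^'n"
  assumes psd: "nonneg_hermitian U" and nz: "U \<noteq> 0"
  shows "\<exists>m (T :: 'n \<Rightarrow> complex mat).
    commuting_tuple m T \<and> ideal_J a U \<subseteq> hereditary_kernel m T \<and> \<not> normal_tuple T"
proof -
  obtain r and V :: "'n \<Rightarrow> nat \<Rightarrow> complex"
    where U: "\<And>j k. U $ j $ k = (\<Sum>i<r. V k i * cnj (V j i))"
    using gram_decomposition[OF psd] by blast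
  \<comment> \<open>The nilpotent part of \<open>T j\<close> sends the basis vector 0 to
    \<open>V j\<close>, placed in the coordinates 1 to r (hence \<open>p - 1\<close>), and kills the
    other basis vectors. So the increment of x depends only on its entry 0.\<close>
  define T :: "'n \<Rightarrow> complex mat" where
    "T j = Matrix.mat (Suc r) (Suc r)
       (\<lambda>(p, q). (if q = p then a $ j else 0) + (if q = 0 then if p = 0 then 0 else V j (p - 1) else 0))" for j
  define u :: "complex vec \<Rightarrow> 'n \<Rightarrow> complex vec" where
    "u x j = Matrix.vec (Suc r) (\<lambda>p. if p = 0 then 0 else V j (p - 1) * x $v 0)" for x j
  have car: "T j \<in> carrier_mat (Suc r) (Suc r)" for j by (simp add: T_def)
  have uc: "u x j \<in> carrier_vec (Suc r)" for x j by (simp add: u_def)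
  have Tx: "T j *\<^sub>v x = a $ j \<cdot>\<^sub>v x + u x j" if x: "x \<in> carrier_vec (Suc r)" for j x
  proof (rule eq_vecI)
    fix p assume "p < dim_vec (a $ j \<cdot>\<^sub>v x + u x j)"
    then have p: "p < Suc r" by (simp add: u_def)
    have "(T j *\<^sub>v x) $v p = (\<Sum>l<Suc r. ((if l = p then a $ j else 0) +
        (if l = 0 then if p = 0 then 0 else V j (p - 1) else 0)) * x $v l)"
      unfolding mult_mat_vec_sum[OF car x p] using p by (intro sum.cong) (auto simp: T_def)
    also have "\<dots> = a $ j * x $v p + (if p = 0 then 0 else V j (p - 1) * x $v 0)"
      using p by (simp only: distrib_right sum.distrib if_distrib[of "\<lambda>t. t * _"] mult_zero_left
          sum.delta finite_lessThan lessThan_iff zero_less_Suc if_True cong: if_cong)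
    finally show "(T j *\<^sub>v x) $v p = (a $ j \<cdot>\<^sub>v x + u x j) $v p"
      using p x by (simp add: u_def)
  qed (use car[of j] in \<open>simp add: u_def\<close>)
  have jet: "first_order_jet (Suc r) T a x (u x)" if x: "x \<in> carrier_vec (Suc r)" for x
  proof -
    have "u (u x j) k = 0\<^sub>v (Suc r)" for j k
      by (intro eq_vecI) (simp_all add: u_def)
    then have "T k *\<^sub>v u x j = a $ k \<cdot>\<^sub>v u x j" for j k
      using Tx[OF uc, of k x j] uc[of x j] by simp
    then show ?thesis using x Tx[OF x] uc by (simp add: first_order_jet_def)
  qed
  have comm: "commuting_tuple (Suc r) T"
    using jet by (intro commuting_tuple_if_jets[OF car]) blast
  have "f \<in> hereditary_kernel (Suc r) T" if f: "f \<in> ideal_J a U" for f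
  proof -
    let ?g = "grad_z f a (cnj_vec a)" and ?h = "grad_zbar f a (cnj_vec a)"
      and ?K = "hess_z_zbar f a (cnj_vec a)"
    have f0: "poly_subst f a (cnj_vec a) = 0" and Ug: "U *v ?g = 0" and Uh: "cnj_mat U *v ?h = 0"
      and tr: "trace (U ** ?K) = 0"
      using f by (auto simp: ideal_J_def)
    have "(hereditary (Suc r) T f *\<^sub>v x) \<bullet>c y = 0"
      if x: "x \<in> carrier_vec (Suc r)" and y: "y \<in> carrier_vec (Suc r)" for x y
    proof -
      have "(\<Sum>j\<in>UNIV. ?g $ j * (u x j \<bullet>c y)) =
        (\<Sum>i<r. (\<Sum>j\<in>UNIV. ?g $ j * V j i) * (x $v 0 * cnj (y $v Suc i)))"
        by (simp add: cscalar_prod_sum[OF y] u_def sum.lessThan_Suc_shift sum_distrib_left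
            sum_distrib_right sum.swap[of _ _ "{..<r}"] mult.assoc del: sum.lessThan_Suc)
      then have g: "(\<Sum>j\<in>UNIV. ?g $ j * (u x j \<bullet>c y)) = 0"
        using Ug by (simp add: nonneg_hermitian_gram(2)[of U V r, OF U])
      have "(\<Sum>k\<in>UNIV. ?h $ k * (x \<bullet>c u y k)) =
        (\<Sum>i<r. (\<Sum>k\<in>UNIV. ?h $ k * cnj (V k i)) * (x $v Suc i * cnj (y $v 0)))"
        by (simp add: cscalar_prod_sum[OF uc] sum.lessThan_Suc_shift del: sum.lessThan_Suc)
          (simp add: u_def sum_distrib_left sum_distrib_right sum.swap[of _ _ "{..<r}"] mult_ac)
      then have h: "(\<Sum>k\<in>UNIV. ?h $ k * (x \<bullet>c u y k)) = 0"
        using Uh by (simp add: nonneg_hermitian_gram(3)[of U V r, OF U])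
      have "u x j \<bullet>c u y k = x $v 0 * cnj (y $v 0) * U $ k $ j" for j k
        by (simp add: cscalar_prod_sum[OF uc] sum.lessThan_Suc_shift del: sum.lessThan_Suc)
          (simp add: u_def U sum_distrib_left mult_ac)
      then have "(\<Sum>j\<in>UNIV. \<Sum>k\<in>UNIV. ?K $ j $ k * (u x j \<bullet>c u y k)) =
        x $v 0 * cnj (y $v 0) * trace (U ** ?K)"
        by (simp add: trace_mult sum_distrib_left mult_ac)
      then show ?thesis
        by (simp add: hereditary_jet[OF comm jet[OF x] jet[OF y]] f0 g h tr)
    qed
    then show ?thesis
      unfolding hereditary_kernel_def using mat_eq_zero_if_form_zero[OF hereditary_carrier] by blast
  qed
  moreover have "\<not> normal_tuple T"
  proof
    assume normal: "normal_tuple T"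
    \<comment> \<open>Row 0 of \<open>T j\<close> contains only \<open>a $ j\<close>, while column 0
      also contains \<open>V j\<close>; equality of the (0,0) entries makes the squared length of
      \<open>V j\<close> zero.\<close>
    have V0: "V j i = 0" if i: "i < r" for j i
    proof -
      note acar = mat_adjoint_carrier[OF car[of j]]
      have "(T j * mat_adjoint (T j)) $$ (0, 0) = (mat_adjoint (T j) * T j) $$ (0, 0)"
        using normal by (simp add: normal_tuple_def)
      moreover have "(T j * mat_adjoint (T j)) $$ (0, 0) = (\<Sum>l<Suc r. T j $$ (0, l) * cnj (T j $$ (0, l)))"
        using carrier_matD[OF acar] carrier_matD[OF car[of j]]
        by (simp add: scalar_prod_def mat_adjoint_index[OF car] lessThan_atLeast0 del: sum.op_ivl_Suc)
      moreover have "(mat_adjoint (T j) * T j) $$ (0, 0) = (\<Sum>l<Suc r. cnj (T j $$ (l, 0)) * T j $$ (l, 0))"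
        using carrier_matD[OF acar] carrier_matD[OF car[of j]]
        by (simp add: scalar_prod_def mat_adjoint_index[OF car] lessThan_atLeast0 del: sum.op_ivl_Suc)
      ultimately have "(\<Sum>l<r. cnj (V j l) * V j l) = 0"
        by (simp add: sum.lessThan_Suc_shift T_def del: sum.lessThan_Suc)
      then have "(\<Sum>l<r. (cmod (V j l))\<^sup>2) = 0"
        by (simp only: mult.commute[of "cnj _"] complex_norm_square[symmetric] of_real_sum[symmetric]
            of_real_eq_0_iff)
      then show ?thesis using i by (simp add: sum_nonneg_eq_0_iff)
    qed
    then have "U = 0" by (simp add: Finite_Cartesian_Product.vec_eq_iff U)
    then show False using nz by simp
  qed
  ultimately show ?thesis using comm by blast
qed

theorem theorem4p4:
  fixes I :: "'n::finite zpoly set"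
  assumes "is_ideal I"
  shows "(\<forall>(m::nat) (T :: 'n \<Rightarrow> complex mat).
            commuting_tuple m T \<and> I \<subseteq> hereditary_kernel m T \<longrightarrow> normal_tuple T)
     \<longleftrightarrow>
         (\<forall>(a :: complex^'n) (b :: complex^'n). a \<noteq> b \<longrightarrow> \<not> I \<subseteq> ideal_I a b) \<and>
         (\<forall>(a :: complex^'n) (U :: complex^'n^'n).
            nonneg_hermitian U \<and> U \<noteq> 0 \<longrightarrow> \<not> I \<subseteq> ideal_J a U)"
    (is "?Sf \<longleftrightarrow> ?GI \<and> ?GJ")
proof
  assume Sf: ?Sf
  have ?GI
  proof (intro allI impI notI)
    fix a b :: "complex^'n" assume ab: "a \<noteq> b" and I: "I \<subseteq> ideal_I a b"
    obtain m and T :: "'n \<Rightarrow> complex mat" where T: "commuting_tuple m T"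
      "ideal_I a b \<subseteq> hereditary_kernel m T" "\<not> normal_tuple T"
      using ideal_I_subset_kernel[OF ab] by (elim exE conjE)
    then show False using Sf[rule_format, of m T] subset_trans[OF I T(2)] by simp
  qed
  moreover have ?GJ
  proof (intro allI impI notI)
    fix a :: "complex^'n" and U :: "complex^'n^'n"
    assume U: "nonneg_hermitian U \<and> U \<noteq> 0" and I: "I \<subseteq> ideal_J a U"
    obtain m and T :: "'n \<Rightarrow> complex mat" where T: "commuting_tuple m T"
      "ideal_J a U \<subseteq> hereditary_kernel m T" "\<not> normal_tuple T"
      using ideal_J_subset_kernel[OF conjunct1[OF U] conjunct2[OF U], of a] by (elim exE conjE)
    then show False using Sf[rule_format, of m T] subset_trans[OF I T(2)] by simp
  qed
  ultimately show "?GI \<and> ?GJ" ..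
next
  assume G: "?GI \<and> ?GJ"
  show ?Sf
  proof (intro allI impI, elim conjE)
    fix m and T :: "'n \<Rightarrow> complex mat"
    assume T: "commuting_tuple m T" and I: "I \<subseteq> hereditary_kernel m T"
    show "normal_tuple T"
    proof (rule normal_if_orthogonal_eigenspaces[OF T])
      fix a b :: "complex^'n" and x y
      assume ab: "a \<noteq> b" and xy: "x \<in> joint_eigenspace m T a" "y \<in> joint_eigenspace m T b"
      show "x \<bullet>c y = 0"
      proof (rule ccontr)
        assume "x \<bullet>c y \<noteq> 0"
        then have "I \<subseteq> ideal_I a b" using I kernel_subset_ideal_I[OF T xy] by simp
        then show False using conjunct1[OF G] ab by simp
      qed
    next
      show "carrier_vec m \<subseteq> eigen_sums m T UNIV"
      proof (rule ccontr)
        assume "\<not> ?thesis"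
        then obtain c :: "complex^'n" and x u j where "first_order_jet m T c x u" "u j \<noteq> 0\<^sub>v m"
          by (rule exists_first_order_jet[OF T])
        from kernel_subset_ideal_J[OF T this] obtain U where "nonneg_hermitian U" "U \<noteq> 0"
          "hereditary_kernel m T \<subseteq> ideal_J c U"
          by (elim exE conjE)
        then show False using conjunct2[OF G, rule_format, of U c] I by simp
      qed
    qed
  qed
qed

end
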